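(* Suppose that $F=f+g$ is bounded below; $\nabla f$ is $L$-Lipschitz continuous on $\mathbb{R}^d$ (with $L>0$); $g$ is closed and separable, i.e. $g(\mathbf{x})=\sum_{i=1}^p g_i(x_i)$; there is $s\in\mathbb{N}$ (possibly $0$) such that for all $i,j,t$, $0\le t-\tau_j^i(t)\le s$ and $\tau_i^i(t)=t$; every machine updates at every time step, i.e. $t\in T_i$ for all $i=1,\ldots,p$ and all $t$; and let $F$ satisfy the Kurdyka-Łojasiewicz (KŁ) property. Fix any $r>1$, put $C=\frac{r^{s+1}-1}{r-1}$, and let the step size $\eta>0$ satisfy $\eta<\frac{1}{L(1+2\sqrt{p}\,C+2\sqrt{p}\,s)}$. Suppose that on each local sequence $\{\mathbf{x}^i(t)\}$ generated by m-PAPG with step size $\eta$, the pair $(f,g)$ satisfies the proximal Lipschitz property, with the inequality holding at the parameter $\theta=\eta$ with constant $L_\eta\le\frac{r^2-1}{2pr^2C^2}$, and that the global sequence $\{\mathbf{x}(t)\}$ is bounded. Then $$\sum_{t=0}^\infty\|\mathbf{x}(t+1)-\mathbf{x}(t)\|<\infty,\qquad \sum_{t=0}^\infty\|\mathbf{x}^i(t+1)-\mathbf{x}^i(t)\|<\infty\quad\text{for all } i=1,\ldots,p.$$ In particular, $\{\mathbf{x}(t)\}$ and $\{\mathbf{x}^i(t)\}$, $i=1,\ldots,p$, converge to the same critical point of $F$.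
   Context: Setting. $\mathbb{R}^d=\mathbb{R}^{d_1}\times\cdots\times\mathbb{R}^{d_p}$, $\mathbf{x}=(x_1,\ldots,x_p)$ with $x_i\in\mathbb{R}^{d_i}$; $\|\cdot\|$ is the Euclidean norm. $f:\mathbb{R}^d\to\mathbb{R}$ is differentiable, with $i$-th block of the gradient denoted $\nabla_i f:\mathbb{R}^d\to\mathbb{R}^{d_i}$; $g:\mathbb{R}^d\to(-\infty,+\infty]$ and $g_i:\mathbb{R}^{d_i}\to(-\infty,+\infty]$ are proper (not identically $+\infty$) and closed (all sublevel sets closed). $F=f+g$. Proximal map: $\mathrm{prox}_h^{\eta}(x)=\operatorname{argmin}_z\, h(z)+\frac{1}{2\eta}\|z-x\|^2$; if it is multi-valued, a single-valued selection is fixed (blockwise, $\mathrm{prox}_g^\eta(\mathbf{x})=(\mathrm{prox}_{g_1}^\eta(x_1),\ldots,\mathrm{prox}_{g_p}^\eta(x_p))$), and $\mathrm{prox}$ denotes this same selection in the algorithm and in the definition of $\Delta_\theta$ below. m-PAPG algorithm. Time is $t=0,1,2,\ldots$. For each machine $i\in\{1,\ldots,p\}$ a set $T_i\subseteq\{0,1,2,\ldots\}$ of active clocks is given, and for all $i,j,t$ an integer $\tau_j^i(t)$ with $0\le\tau_j^i(t)\le t$. From an initial point $\mathbf{x}(0)\in\mathbb{R}^d$ and a step size $\eta>0$, the global sequence $\mathbf{x}(t)=(x_1(t),\ldots,x_p(t))$ and the local sequences $\mathbf{x}^i(t)=(x_1(\tau_1^i(t)),\ldots,x_p(\tau_p^i(t)))$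 are generated by: for each $i$, $x_i(t+1)=x_i(t)$ if $t\notin T_i$, and $x_i(t+1)=\mathrm{prox}_{g_i}^{\eta}\big(x_i(t)-\eta\nabla_i f(\mathbf{x}^i(t))\big)$ if $t\in T_i$. Proximal Lipschitz property: for $\theta>0$ let $\Delta_\theta(\mathbf{x})=\mathrm{prox}_g^{\theta}(\mathbf{x}-\theta\nabla f(\mathbf{x}))-\mathbf{x}$. The pair $(f,g)$ satisfies the proximal Lipschitz property on a sequence $\{\mathbf{y}(t)\}$ if for all sufficiently small $\theta>0$ there exists $L_\theta$, with $L_\theta\to0$ as $\theta\to0$, such that for all large $t$, $\|\Delta_\theta(\mathbf{y}(t))-\Delta_\theta(\mathbf{y}(t+1))\|\le L_\theta\|\mathbf{y}(t)-\mathbf{y}(t+1)\|$. Subdifferential and critical points: for proper closed $h$ and $\mathbf{x}\in\operatorname{dom}h$, the Fréchet subdifferential $\hat\partial h(\mathbf{x})$ is the set of $\mathbf{u}$ with $\liminf_{\mathbf{z}\to\mathbf{x},\mathbf{z}\ne\mathbf{x}}\frac{h(\mathbf{z})-h(\mathbf{x})-\mathbf{u}^\top(\mathbf{z}-\mathbf{x})}{\|\mathbf{z}-\mathbf{x}\|}\ge0$; the limiting subdifferential is $\partial h(\mathbf{x})=\{\mathbf{u}:\exists\,\mathbf{x}^k\to\mathbf{x},\ h(\mathbf{x}^k)\to h(\mathbf{x}),\ \mathbf{u}^k\in\hat\partial h(\mathbf{x}^k),\ \mathbf{u}^k\to\mathbf{u}\}$; critical points are the elements of $\operatorname{crit}h=\{\mathbf{x}:\mathbf{0}\in\partial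 h(\mathbf{x})\}$. $\mathrm{dist}_\Omega(\mathbf{x})=\min_{\mathbf{y}\in\Omega}\|\mathbf{y}-\mathbf{x}\|$ for closed $\Omega$ (with value $+\infty$ if $\Omega=\emptyset$). KŁ property: $h$ satisfies the KŁ property if for every compact set $\Omega\subset\operatorname{dom}h$ on which $h$ is constant there exist $\varepsilon,\lambda>0$ and a continuous concave function $\varphi:[0,\lambda)\to\mathbb{R}_+$ with $\varphi(0)=0$ and with continuous and positive derivative $\varphi'$ on $(0,\lambda)$, such that for all $\bar{\mathbf{x}}\in\Omega$ and all $\mathbf{x}$ with $\mathrm{dist}_\Omega(\mathbf{x})<\varepsilon$ and $h(\bar{\mathbf{x}})<h(\mathbf{x})<h(\bar{\mathbf{x}})+\lambda$, one has $\varphi'(h(\mathbf{x})-h(\bar{\mathbf{x}}))\cdot\mathrm{dist}_{\partial h(\mathbf{x})}(\mathbf{0})\ge1$. *)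

theory Defs
  imports "HOL-Analysis.Analysis"
begin

text \<open>
  The product of the spaces \<open>R^(d_i)\<close>, for \<open>i\<close> in the finite type of machines \<open>'p\<close>, is modelled by
  \<open>real ^ 'n\<close> together with a map \<open>b :: 'n \<Rightarrow> 'p\<close> assigning to each coordinate the block it belongs
  to, so \<open>d_i = card {k. b k = i}\<close> and the \<open>d_i\<close> may differ. The factor \<open>R^(d_i)\<close> is the subspace of
  vectors supported on block \<open>i\<close>; it carries the Euclidean norm of \<open>R^(d_i)\<close>.
\<close>

definition block_space :: "('n::finite \<Rightarrow> 'p) \<Rightarrow> 'p \<Rightarrow> (real ^ 'n) set" where
  "block_space b i = {v. \<forall>k. b k \<noteq> i \<longrightarrow> v $ k = 0}"

definition block :: "('n::finite \<Rightarrow> 'p) \<Rightarrow> 'p \<Rightarrow> real ^ 'n \<Rightarrow> real ^ 'n" where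
  "block b i v = (\<chi> k. if b k = i then v $ k else 0)"

definition join_blocks :: "('n::finite \<Rightarrow> 'p) \<Rightarrow> ('p \<Rightarrow> real ^ 'n) \<Rightarrow> real ^ 'n" where
  "join_blocks b v = (\<chi> k. v (b k) $ k)"

text \<open>
  Functions on a set \<open>D\<close> with values in \<open>(-\<infinity>, \<infinity>]\<close> are total functions into \<open>ereal\<close> of which
  only the values on \<open>D\<close> matter.
\<close>

definition proper_closed_on :: "'a::topological_space set \<Rightarrow> ('a \<Rightarrow> ereal) \<Rightarrow> bool" where
  "proper_closed_on D h \<longleftrightarrow>
     (\<forall>x\<in>D. h x \<noteq> -\<infinity>) \<and> (\<exists>x\<in>D. h x \<noteq> \<infinity>) \<and>
     (\<forall>a::real. closedin (top_of_set D) {x\<in>D. h x \<le> ereal a})"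

definition effective_dom :: "('a \<Rightarrow> ereal) \<Rightarrow> 'a set" where
  "effective_dom h = {x. h x < \<infinity>}"

definition frechet_subdiff :: "('a::euclidean_space \<Rightarrow> ereal) \<Rightarrow> 'a \<Rightarrow> 'a set" where
  "frechet_subdiff h x =
     {u. x \<in> effective_dom h \<and>
         0 \<le> Liminf (at x) (\<lambda>z. (h z - h x - ereal (u \<bullet> (z - x))) / ereal (norm (z - x)))}"

definition limiting_subdiff :: "('a::euclidean_space \<Rightarrow> ereal) \<Rightarrow> 'a \<Rightarrow> 'a set" where
  "limiting_subdiff h x =
     {u. x \<in> effective_dom h \<and>
         (\<exists>X U. X \<longlonglongrightarrow> x \<and> (\<lambda>k. h (X k)) \<longlonglongrightarrow> h x \<and>
                (\<forall>k. U k \<in> frechet_subdiff h (X k)) \<and> U \<longlonglongrightarrow> u)}"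

definition crit :: "('a::euclidean_space \<Rightarrow> ereal) \<Rightarrow> 'a set" where
  "crit h = {x. 0 \<in> limiting_subdiff h x}"

text \<open>
  Unlike the library's \<open>infdist\<close>, which is \<open>0\<close> for the empty set, this distance is \<open>\<infinity>\<close> there.
\<close>

definition edist_to :: "'a::metric_space set \<Rightarrow> 'a \<Rightarrow> ereal" where
  "edist_to S x = (INF y\<in>S. ereal (dist y x))"

definition KL_property :: "('a::euclidean_space \<Rightarrow> ereal) \<Rightarrow> bool" where
  "KL_property h \<longleftrightarrow>
     (\<forall>\<Omega>. compact \<Omega> \<and> \<Omega> \<subseteq> effective_dom h \<and> (\<exists>c. \<forall>y\<in>\<Omega>. h y = c) \<longrightarrow>
       (\<exists>(\<epsilon>::real) (l::real) (\<phi>::real \<Rightarrow> real) (\<phi>'::real \<Rightarrow> real).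
          0 < \<epsilon> \<and> 0 < l \<and>
          continuous_on {0..<l} \<phi> \<and> concave_on {0..<l} \<phi> \<and>
          (\<forall>a\<in>{0..<l}. 0 \<le> \<phi> a) \<and> \<phi> 0 = 0 \<and>
          (\<forall>a\<in>{0<..<l}. (\<phi> has_real_derivative \<phi>' a) (at a) \<and> 0 < \<phi>' a) \<and>
          continuous_on {0<..<l} \<phi>' \<and>
          (\<forall>y\<in>\<Omega>. \<forall>x. edist_to \<Omega> x < ereal \<epsilon> \<and> h y < h x \<and> h x < h y + ereal l \<longrightarrow>
             1 \<le> ereal (\<phi>' (real_of_ereal (h x - h y))) * edist_to (limiting_subdiff h x) 0)))"

definition prox_set :: "'a::real_inner set \<Rightarrow> ('a \<Rightarrow> ereal) \<Rightarrow> real \<Rightarrow> 'a \<Rightarrow> 'a set" where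
  "prox_set D h \<eta> x =
     {z\<in>D. \<forall>w\<in>D. h z + ereal (1 / (2 * \<eta>) * (norm (z - x))\<^sup>2)
                \<le> h w + ereal (1 / (2 * \<eta>) * (norm (w - x))\<^sup>2)}"

text \<open>
  \<open>P i \<eta> x\<close> is the fixed selection of the (possibly multi-valued) proximal map of \<open>g i\<close>. The argmin
  may be empty (for large \<open>\<eta>\<close>), and nothing is required of the selection there.
\<close>

definition prox_selection ::
    "('n::finite \<Rightarrow> 'p) \<Rightarrow> ('p \<Rightarrow> real ^ 'n \<Rightarrow> ereal) \<Rightarrow>
     ('p \<Rightarrow> real \<Rightarrow> real ^ 'n \<Rightarrow> real ^ 'n) \<Rightarrow> bool" where
  "prox_selection b g P \<longleftrightarrow>
     (\<forall>i \<eta>. \<forall>x\<in>block_space b i. 0 < \<eta> \<and> prox_set (block_space b i) (g i) \<eta> x \<noteq> {} \<longrightarrow>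
        P i \<eta> x \<in> prox_set (block_space b i) (g i) \<eta> x)"

text \<open>\<open>Df\<close> is the gradient of \<open>f\<close>.\<close>

definition prox_residual ::
    "('n::finite \<Rightarrow> 'p) \<Rightarrow> ('p \<Rightarrow> real \<Rightarrow> real ^ 'n \<Rightarrow> real ^ 'n) \<Rightarrow> (real ^ 'n \<Rightarrow> real ^ 'n) \<Rightarrow>
     real \<Rightarrow> real ^ 'n \<Rightarrow> real ^ 'n" where
  "prox_residual b P Df \<theta> x =
     join_blocks b (\<lambda>i. P i \<theta> (block b i (x - \<theta> *\<^sub>R Df x))) - x"

definition prox_lipschitz_at :: "(real \<Rightarrow> 'a \<Rightarrow> 'a) \<Rightarrow> real \<Rightarrow> real \<Rightarrow> (nat \<Rightarrow> 'a::real_normed_vector) \<Rightarrow> bool" where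
  "prox_lipschitz_at \<Delta> \<theta> c y \<longleftrightarrow>
     (\<forall>\<^sub>F t in sequentially. norm (\<Delta> \<theta> (y t) - \<Delta> \<theta> (y (Suc t))) \<le> c * norm (y t - y (Suc t)))"

text \<open>The constants \<open>L_\<theta>\<close> of the property are given by the function \<open>\<Lambda>\<close>.\<close>

definition proximal_lipschitz_with ::
    "(real \<Rightarrow> real) \<Rightarrow> (real \<Rightarrow> 'a \<Rightarrow> 'a) \<Rightarrow> (nat \<Rightarrow> 'a::real_normed_vector) \<Rightarrow> bool" where
  "proximal_lipschitz_with \<Lambda> \<Delta> y \<longleftrightarrow>
     (\<Lambda> \<longlongrightarrow> 0) (at_right 0) \<and>
     (\<forall>\<^sub>F \<theta> in at_right 0. prox_lipschitz_at \<Delta> \<theta> (\<Lambda> \<theta>) y)"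

definition local_seq ::
    "('n::finite \<Rightarrow> 'p) \<Rightarrow> ('p \<Rightarrow> 'p \<Rightarrow> nat \<Rightarrow> nat) \<Rightarrow> (nat \<Rightarrow> real ^ 'n) \<Rightarrow> 'p \<Rightarrow> nat \<Rightarrow> real ^ 'n" where
  "local_seq b \<tau> x i t = join_blocks b (\<lambda>j. x (\<tau> i j t))"

definition mPAPG ::
    "('n::finite \<Rightarrow> 'p) \<Rightarrow> ('p \<Rightarrow> nat set) \<Rightarrow> ('p \<Rightarrow> 'p \<Rightarrow> nat \<Rightarrow> nat) \<Rightarrow>
     ('p \<Rightarrow> real \<Rightarrow> real ^ 'n \<Rightarrow> real ^ 'n) \<Rightarrow> (real ^ 'n \<Rightarrow> real ^ 'n) \<Rightarrow> real \<Rightarrow>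
     (nat \<Rightarrow> real ^ 'n) \<Rightarrow> bool" where
  "mPAPG b T \<tau> P Df \<eta> x \<longleftrightarrow>
     (\<forall>i t. block b i (x (Suc t)) =
        (if t \<in> T i
         then P i \<eta> (block b i (x t) - \<eta> *\<^sub>R block b i (Df (local_seq b \<tau> x i t)))
         else block b i (x t)))"

end

theory Submission
  imports Defs
begin

text \<open>
  Each \<open>x(t+1)\<close> is a proximal point of \<open>g\<close> at \<open>x(t) - \<eta> G(t)\<close>, where \<open>G(t)\<close> collects the delayed block
  gradients; it differs from \<open>\<nabla>f(x(t))\<close> and \<open>\<nabla>f(x(t+1))\<close> by at most \<open>\<surd>p L\<close> times the sum of the
  increments \<open>a(k) = \<parallel>x(k+1) - x(k)\<parallel>\<close> over the window \<open>t - s \<le> k \<le> t\<close>. The proximal Lipschitz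
  inequality says that increments cannot shrink too fast: if \<open>a(k) \<le> r^(t-k) a(t)\<close> on the window
  ending at \<open>t\<close>, then \<open>a(t) \<le> r a(t+1)\<close>, so the property passes to \<open>t+1\<close>. As the inequality is
  only available for large \<open>t\<close>, this induction may have no starting point; but if the window
  property fails at every large \<open>t\<close>, then \<open>a\<close> decays geometrically and is summable. Otherwise every
  window sum is eventually at most \<open>C a(t)\<close>, which gives \<open>F(x(t+1)) \<le> F(x(t)) - \<alpha> a(t)\<^sup>2\<close> and a
  subgradient of \<open>F\<close> at \<open>x(t)\<close> of norm at most \<open>\<beta> a(t)\<close>; the KL inequality with the concavity of
  \<open>\<phi>\<close> then bounds \<open>a(t)\<close> by a telescoping difference. In both cases the subgradients tend to \<open>0\<close>,
  and \<open>F\<close> converges along the iterates by minimality of the proximal points, so the limit is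
  critical.
\<close>

section \<open>Blocks\<close>

lemma block_nth [simp]: "block b i v $ k = (if b k = i then v $ k else 0)"
  by (simp add: block_def)

lemma join_blocks_nth [simp]: "join_blocks b v $ k = v (b k) $ k"
  by (simp add: join_blocks_def)

lemma block_add: "block b i (u + v) = block b i u + block b i v"
  and block_diff: "block b i (u - v) = block b i u - block b i v"
  and block_scaleR: "block b i (c *\<^sub>R v) = c *\<^sub>R block b i v"
  and block_idem [simp]: "block b i (block b i v) = block b i v"
  and block_join [simp]: "block b i (join_blocks b w) = block b i (w i)"
  and join_blocks_const [simp]: "join_blocks b (\<lambda>_. v) = v"
  and block_in_space [simp]: "block b i v \<in> block_space b i"
  by (auto simp: vec_eq_iff block_space_def)

lemma block_of_space: "v \<in> block_space b i \<Longrightarrow> block b i v = v"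
  by (auto simp: vec_eq_iff block_space_def)

lemma inner_blocks:
  fixes b :: "'n::finite \<Rightarrow> 'p::finite"
  shows "u \<bullet> v = (\<Sum>i\<in>UNIV. block b i u \<bullet> block b i v)"
proof -
  have "(\<Sum>i\<in>UNIV. block b i u \<bullet> block b i v)
      = (\<Sum>i\<in>UNIV. \<Sum>k\<in>UNIV. if b k = i then u $ k * v $ k else 0)"
    by (auto simp: inner_vec_def intro!: sum.cong)
  also have "\<dots> = (\<Sum>k\<in>UNIV. \<Sum>i\<in>UNIV. if b k = i then u $ k * v $ k else 0)"
    by (rule sum.swap)
  also have "\<dots> = u \<bullet> v"
    by (simp add: inner_vec_def)
  finally show ?thesis ..
qed

lemma norm_sq_blocks:
  fixes b :: "'n::finite \<Rightarrow> 'p::finite"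
  shows "(norm v)\<^sup>2 = (\<Sum>i\<in>UNIV. (norm (block b i v))\<^sup>2)"
  unfolding power2_norm_eq_inner by (rule inner_blocks)

lemma norm_block_le: "norm (block b i v) \<le> norm v"
  by (rule norm_le_componentwise_cart) auto

text \<open>Every later factor \<open>sqrt (real CARD('p))\<close> in an estimate originates here:
  bounds are proved machine by machine, since each machine sees its own delayed point, and are then
  assembled.\<close>

lemma norm_le_sqrt_card_blocks:
  fixes b :: "'n::finite \<Rightarrow> 'p::finite"
  assumes "\<And>i. norm (block b i v) \<le> c"
  shows "norm v \<le> sqrt (real CARD('p)) * c"
proof -
  have "0 \<le> c"
    using assms norm_ge_zero order_trans by blast
  have "(norm v)\<^sup>2 \<le> (\<Sum>i\<in>(UNIV::'p set). c\<^sup>2)"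
    unfolding norm_sq_blocks[of v b] using assms by (intro sum_mono power_mono) auto
  also have "\<dots> = (sqrt (real CARD('p)) * c)\<^sup>2"
    by (simp add: power_mult_distrib)
  finally show ?thesis
    by (rule power2_le_imp_le) (simp add: \<open>0 \<le> c\<close>)
qed

text \<open>A blockwise estimate would cost a factor sqrt p. Instead each coordinate telescopes
  along its own times and is dominated by the same coordinate of the sum of the vectors of absolute
  increments, to which the triangle inequality applies.\<close>

lemma norm_delayed_diff_le:
  fixes x :: "nat \<Rightarrow> real ^ 'n::finite" and b :: "'n \<Rightarrow> 'p"
  assumes \<sigma>: "\<And>j. \<sigma> j \<in> {m..n}" and \<rho>: "\<And>j. \<rho> j \<in> {m..n}"
  shows "norm (join_blocks b (\<lambda>j. x (\<sigma> j)) - join_blocks b (\<lambda>j. x (\<rho> j)))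
         \<le> (\<Sum>k\<in>{m..<n}. norm (x (Suc k) - x k))"
proof -
  let ?A = "\<lambda>k. (\<chi> l. \<bar>(x (Suc k) - x k) $ l\<bar>) :: real ^ 'n"
  have step: "\<bar>x q $ l - x p $ l\<bar> \<le> (\<Sum>k\<in>{m..<n}. \<bar>(x (Suc k) - x k) $ l\<bar>)"
    if "m \<le> p" "p \<le> q" "q \<le> n" for p q l
  proof -
    have "x q $ l - x p $ l = (\<Sum>k\<in>{p..<q}. x (Suc k) $ l - x k $ l)"
      using sum_Suc_diff'[of p q "\<lambda>k. x k $ l"] that by simp
    also have "\<bar>\<dots>\<bar> \<le> (\<Sum>k\<in>{p..<q}. \<bar>x (Suc k) $ l - x k $ l\<bar>)"
      by (rule sum_abs)
    also have "\<dots> \<le> (\<Sum>k\<in>{m..<n}. \<bar>x (Suc k) $ l - x k $ l\<bar>)"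
      using that by (intro sum_mono2) auto
    finally show ?thesis by simp
  qed
  have "norm (join_blocks b (\<lambda>j. x (\<sigma> j)) - join_blocks b (\<lambda>j. x (\<rho> j)))
      \<le> norm (\<Sum>k\<in>{m..<n}. ?A k)"
  proof (rule norm_le_componentwise_cart)
    fix l
    have "\<bar>x (\<sigma> (b l)) $ l - x (\<rho> (b l)) $ l\<bar> \<le> (\<Sum>k\<in>{m..<n}. \<bar>(x (Suc k) - x k) $ l\<bar>)"
      using step[of "\<rho> (b l)" "\<sigma> (b l)" l] step[of "\<sigma> (b l)" "\<rho> (b l)" l] \<sigma>[of "b l"] \<rho>[of "b l"]
      by (cases "\<rho> (b l) \<le> \<sigma> (b l)") (auto simp: abs_minus_commute)
    also have "\<dots> \<le> norm ((\<Sum>k\<in>{m..<n}. ?A k) $ l)"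
      by (simp add: abs_le_iff)
    finally show "norm ((join_blocks b (\<lambda>j. x (\<sigma> j)) - join_blocks b (\<lambda>j. x (\<rho> j))) $ l)
        \<le> norm ((\<Sum>k\<in>{m..<n}. ?A k) $ l)"
      by simp
  qed
  also have "\<dots> \<le> (\<Sum>k\<in>{m..<n}. norm (?A k))"
    by (rule norm_sum)
  also have "\<dots> = (\<Sum>k\<in>{m..<n}. norm (x (Suc k) - x k))"
    by (simp add: norm_vec_def)
  finally show ?thesis .
qed

section \<open>Functions with Lipschitz gradient\<close>

text \<open>The descent lemma. Along the segment from \<open>x\<close> to \<open>y\<close> the gap
  \<open>\<psi>\<close> between \<open>f\<close> and its quadratic model has nonpositive derivative,
  by Cauchy-Schwarz and the Lipschitz bound.\<close>

lemma lipschitz_gradient_upper: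
  fixes f :: "'a::real_inner \<Rightarrow> real"
  assumes grad: "\<And>y. GDERIV f y :> Df y" and lip: "L-lipschitz_on UNIV Df"
  shows "f y \<le> f x + Df x \<bullet> (y - x) + L / 2 * (norm (y - x))\<^sup>2"
proof -
  define d where "d = y - x"
  define \<psi> where "\<psi> t = f (x + t *\<^sub>R d) - t * (Df x \<bullet> d) - L / 2 * t\<^sup>2 * (norm d)\<^sup>2" for t
  have deriv: "(\<psi> has_real_derivative ((Df (x + t *\<^sub>R d) - Df x) \<bullet> d - L * t * (norm d)\<^sup>2)) (at t)"
    for t
  proof -
    have "(f has_derivative (\<lambda>h. h \<bullet> Df (x + t *\<^sub>R d))) (at (x + t *\<^sub>R d))"
      using grad by (simp add: gderiv_def)
    moreover have "((\<lambda>t. x + t *\<^sub>R d) has_derivative (\<lambda>h. h *\<^sub>R d)) (at t)"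
      by (auto intro!: derivative_eq_intros)
    ultimately have "((\<lambda>t. f (x + t *\<^sub>R d)) has_derivative (\<lambda>h. (h *\<^sub>R d) \<bullet> Df (x + t *\<^sub>R d))) (at t)"
      by (rule has_derivative_compose[rotated])
    then have "((\<lambda>t. f (x + t *\<^sub>R d)) has_real_derivative (Df (x + t *\<^sub>R d) \<bullet> d)) (at t)"
      by (simp add: has_field_derivative_def inner_commute mult.commute[of _ "_ \<bullet> _"])
    then show ?thesis
      unfolding \<psi>_def by (auto intro!: derivative_eq_intros simp: inner_diff_left)
  qed
  have nonpos: "(Df (x + t *\<^sub>R d) - Df x) \<bullet> d - L * t * (norm d)\<^sup>2 \<le> 0" if "0 \<le> t" for t
  proof -
    have "(Df (x + t *\<^sub>R d) - Df x) \<bullet> d \<le> norm (Df (x + t *\<^sub>R d) - Df x) * norm d"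
      by (rule norm_cauchy_schwarz)
    also have "\<dots> \<le> (L * norm (t *\<^sub>R d)) * norm d"
      using lipschitz_onD[OF lip, of "x + t *\<^sub>R d" x]
      by (intro mult_right_mono) (auto simp: dist_norm)
    finally show ?thesis
      using that by (simp add: power2_eq_square mult_ac)
  qed
  have "\<psi> 1 \<le> \<psi> 0"
    by (rule DERIV_nonpos_imp_nonincreasing[of 0 1 \<psi>]) (simp, intro exI conjI, rule deriv, rule nonpos)
  then show ?thesis
    by (simp add: \<psi>_def d_def)
qed

lemma lipschitz_gradient_lower:
  fixes f :: "'a::real_inner \<Rightarrow> real"
  assumes grad: "\<And>y. GDERIV f y :> Df y" and lip: "L-lipschitz_on UNIV Df"
  shows "f x + Df x \<bullet> (y - x) - L / 2 * (norm (y - x))\<^sup>2 \<le> f y"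
proof -
  have "GDERIV (\<lambda>y. - f y) y :> - Df y" for y
    using grad by (rule GDERIV_minus)
  moreover have "L-lipschitz_on UNIV (\<lambda>y. - Df y)"
    using lip by (simp add: lipschitz_on_def dist_minus)
  ultimately show ?thesis
    using lipschitz_gradient_upper[of "\<lambda>y. - f y" "\<lambda>y. - Df y" L y x] by simp
qed

section \<open>Closed functions and proximal points\<close>

text \<open>Sequential lower semicontinuity: for each \<open>e > 0\<close> a tail of the sequence
  lies in the closed sublevel set at \<open>c0 + e\<close>, hence so does the limit.\<close>

lemma closed_fun_limit_le:
  assumes h: "proper_closed_on D h" and D: "\<And>n. z n \<in> D" "l \<in> D" and z: "z \<longlonglongrightarrow> l"
    and le: "\<And>n. h (z n) \<le> ereal (c n)" and c: "c \<longlonglongrightarrow> c0"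
  shows "h l \<le> ereal c0"
proof (rule ereal_le_epsilon2)
  fix e :: real assume "0 < e"
  have "closedin (top_of_set D) {x\<in>D. h x \<le> ereal (c0 + e)}"
    using h by (auto simp: proper_closed_on_def)
  then obtain K where K: "closed K" "{x\<in>D. h x \<le> ereal (c0 + e)} = D \<inter> K"
    by (auto simp: closedin_closed)
  have "\<forall>\<^sub>F n in sequentially. c n < c0 + e"
    using c \<open>0 < e\<close> by (intro order_tendstoD) auto
  then have "\<forall>\<^sub>F n in sequentially. z n \<in> K"
  proof eventually_elim
    case (elim n)
    then have "h (z n) \<le> ereal (c0 + e)"
      using le[of n] by (meson ereal_less_eq(3) less_imp_le order_trans)
    then show ?case
      using K(2) D(1) by blast
  qed
  then have "l \<in> K"
    using z K(1) by (intro Lim_in_closed_set[OF K(1)]) auto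
  then have "h l \<le> ereal (c0 + e)"
    using K(2) D(2) by blast
  then show "h l \<le> ereal c0 + ereal e"
    by simp
qed

text \<open>The direct method. Since \<open>K < 1 / \<eta>\<close>, the objective grows
  quadratically, so a minimising sequence is bounded, and the limit of a convergent subsequence is a
  minimiser by lower semicontinuity.\<close>

lemma prox_set_nonempty:
  fixes h :: "'a::euclidean_space \<Rightarrow> ereal"
  assumes h: "proper_closed_on D h" and D: "closed D"
    and low: "\<And>z. z \<in> D \<Longrightarrow> ereal (m - A * norm (z - x) - K / 2 * (norm (z - x))\<^sup>2) \<le> h z"
    and \<eta>: "0 < \<eta>" and K: "K < 1 / \<eta>"
  shows "prox_set D h \<eta> x \<noteq> {}"
proof -
  define c where "c = (1 / \<eta> - K) / 2"
  define Q where "Q z = 1 / (2 * \<eta>) * (norm (z - x))\<^sup>2" for z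
  have c: "0 < c"
    using K by (simp add: c_def)
  \<comment> \<open>The real upper bounds of attained objective values; passing to them lets the
    infimum be taken in the reals.\<close>
  define V where "V = {v. \<exists>z\<in>D. h z \<le> ereal (v - Q z)}"
  have growth: "m - A * norm (z - x) + c * (norm (z - x))\<^sup>2 \<le> v"
    if "z \<in> D" "h z \<le> ereal (v - Q z)" for z v
  proof -
    have "ereal (m - A * norm (z - x) - K / 2 * (norm (z - x))\<^sup>2) \<le> ereal (v - Q z)"
      using low that order_trans by blast
    then show ?thesis
      by (simp add: Q_def c_def field_simps)
  qed
  have finite_val: "\<exists>v. h z = ereal v" if "z \<in> D" "h z \<noteq> \<infinity>" for z
    using h that by (cases "h z") (auto simp: proper_closed_on_def)
  have V_ne: "V \<noteq> {}"
  proof -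
    obtain z where z: "z \<in> D" "h z \<noteq> \<infinity>"
      using h by (auto simp: proper_closed_on_def)
    then obtain v where "h z = ereal v"
      using finite_val by blast
    then have "v + Q z \<in> V"
      using z by (auto simp: V_def intro!: bexI[of _ z])
    then show ?thesis by blast
  qed
  have V_bdd: "bdd_below V"
  proof (rule bdd_belowI)
    fix v assume "v \<in> V"
    then obtain z where z: "z \<in> D" "h z \<le> ereal (v - Q z)"
      by (auto simp: V_def)
    \<comment> \<open>Completing the square: the bound is the minimum over the real line of the
      quadratic in \<open>growth\<close>.\<close>
    have "0 \<le> c * (norm (z - x) - A / (2 * c))\<^sup>2"
      using c by simp
    also have "\<dots> = c * (norm (z - x))\<^sup>2 - A * norm (z - x) + A\<^sup>2 / (4 * c)"
      using c by (simp add: power2_eq_square field_simps)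
    finally show "m - A\<^sup>2 / (4 * c) \<le> v"
      using growth[OF z] by simp
  qed
  have "\<exists>v z. v < Inf V + 1 / real (Suc n) \<and> z \<in> D \<and> h z \<le> ereal (v - Q z)" for n
    using cInf_lessD[OF V_ne, of "Inf V + 1 / real (Suc n)"] by (force simp: V_def)
  then obtain v z where vz: "\<And>n. v n < Inf V + 1 / real (Suc n)" "\<And>n. z n \<in> D"
      "\<And>n. h (z n) \<le> ereal (v n - Q (z n))"
    by metis
  have vV: "Inf V \<le> v n" for n
    using vz V_bdd by (intro cInf_lower) (auto simp: V_def)
  have v_lim: "v \<longlonglongrightarrow> Inf V"
  proof (rule tendsto_sandwich[of "\<lambda>_. Inf V"])
    show "(\<lambda>n. Inf V + 1 / real (Suc n)) \<longlonglongrightarrow> Inf V"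
      using LIMSEQ_inverse_real_of_nat_add[of "Inf V"] by (simp only: inverse_eq_divide)
  qed (use vz(1) vV in \<open>auto intro!: always_eventually less_imp_le[OF vz(1)] simp del: of_nat_Suc\<close>)
  \<comment> \<open>Beyond distance 1 the constant and linear terms are at most a multiple of the
    distance, so one factor cancels against the quadratic growth.\<close>
  have "norm (z n - x) \<le> 1 + (\<bar>Inf V + 1 - m\<bar> + \<bar>A\<bar>) / c" for n
  proof (cases "norm (z n - x) \<le> 1")
    case True
    then show ?thesis
      using c by (simp add: add_increasing2)
  next
    case False
    define d where "d = norm (z n - x)"
    have d: "1 \<le> d"
      using False by (simp add: d_def)
    have "v n \<le> Inf V + 1"
    proof -
      have "1 / real (Suc n) \<le> 1" by simp
      then show ?thesis using vz(1)[of n] by linarith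
    qed
    then have "c * d\<^sup>2 \<le> (Inf V + 1 - m) + A * d"
      using growth[OF vz(2,3), of n] by (simp add: d_def)
    also have "\<dots> \<le> \<bar>Inf V + 1 - m\<bar> * d + \<bar>A\<bar> * d"
      using d by (intro add_mono mult_right_mono)
        (auto intro: order_trans[OF abs_ge_self] simp: mult_le_cancel_left1)
    finally have "c * d * d \<le> (\<bar>Inf V + 1 - m\<bar> + \<bar>A\<bar>) * d"
      by (simp add: power2_eq_square algebra_simps)
    then have "c * d \<le> \<bar>Inf V + 1 - m\<bar> + \<bar>A\<bar>"
      using d by simp
    then have "d \<le> (\<bar>Inf V + 1 - m\<bar> + \<bar>A\<bar>) / c"
      using c by (simp add: field_simps)
    then show ?thesis
      by (simp add: d_def)
  qed
  then have "bounded (range (\<lambda>n. z n - x))"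
    by (auto simp: bounded_iff)
  then obtain l q where q: "strict_mono (q :: nat \<Rightarrow> nat)" "((\<lambda>n. z n - x) \<circ> q) \<longlonglongrightarrow> l"
    using bounded_imp_convergent_subsequence by blast
  then have zq: "(\<lambda>n. z (q n)) \<longlonglongrightarrow> l + x"
    using tendsto_add[OF q(2) tendsto_const[of x]] by (simp add: o_def)
  have lD: "l + x \<in> D"
    using vz(2) by (intro Lim_in_closed_set[OF D _ _ zq]) auto
  have "(\<lambda>n. v (q n) - Q (z (q n))) \<longlonglongrightarrow> Inf V - Q (l + x)"
    unfolding Q_def by (intro tendsto_intros zq LIMSEQ_subseq_LIMSEQ[OF v_lim q(1), unfolded o_def])
  then have h_l: "h (l + x) \<le> ereal (Inf V - Q (l + x))"
    using vz by (intro closed_fun_limit_le[OF h _ lD zq]) auto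
  have "h (l + x) + ereal (Q (l + x)) \<le> h w + ereal (Q w)" if w: "w \<in> D" for w
  proof (cases "h w = \<infinity>")
    case False
    then obtain a where a: "h w = ereal a"
      using finite_val w by blast
    then have "Inf V \<le> a + Q w"
      using w V_bdd by (intro cInf_lower) (auto simp: V_def intro!: bexI[of _ w])
    moreover have "h (l + x) + ereal (Q (l + x)) \<le> ereal (Inf V - Q (l + x)) + ereal (Q (l + x))"
      by (intro add_right_mono h_l)
    ultimately show ?thesis
      using a by (simp add: order_trans)
  qed simp
  then have "l + x \<in> prox_set D h \<eta> x"
    using lD by (simp add: prox_set_def Q_def)
  then show ?thesis by blast
qed

text \<open>The squared norm splits over the blocks just as \<open>g\<close> does, so the objective
  is a sum of independent block objectives.\<close>

lemma prox_set_separable: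
  fixes b :: "'n::finite \<Rightarrow> 'p::finite"
  assumes g: "\<And>y. g y = (\<Sum>i\<in>UNIV. gi i (block b i y))"
    and z: "\<And>i. block b i z \<in> prox_set (block_space b i) (gi i) \<eta> (block b i v)"
  shows "z \<in> prox_set UNIV g \<eta> v"
proof -
  have eq: "g w + ereal (1 / (2 * \<eta>) * (norm (w - v))\<^sup>2) =
      (\<Sum>i\<in>UNIV. gi i (block b i w) + ereal (1 / (2 * \<eta>) * (norm (block b i w - block b i v))\<^sup>2))" for w
    unfolding sum.distrib sum_ereal sum_distrib_left[symmetric] g block_diff[symmetric] norm_sq_blocks[of "w - v" b] ..
  have "g z + ereal (1 / (2 * \<eta>) * (norm (z - v))\<^sup>2) \<le> g w + ereal (1 / (2 * \<eta>) * (norm (w - v))\<^sup>2)" for w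
    unfolding eq using z by (intro sum_mono) (auto simp: prox_set_def)
  then show ?thesis
    by (simp add: prox_set_def)
qed

lemma prox_set_finite:
  assumes h: "proper_closed_on D h" and z: "z \<in> prox_set D h \<eta> v"
  shows "\<exists>c. h z = ereal c"
proof -
  obtain w where w: "w \<in> D" "h w \<noteq> \<infinity>"
    using h by (auto simp: proper_closed_on_def)
  then have "h z + ereal (1 / (2 * \<eta>) * (norm (z - v))\<^sup>2) \<le> h w + ereal (1 / (2 * \<eta>) * (norm (w - v))\<^sup>2)"
    using z by (auto simp: prox_set_def)
  moreover have "h z \<noteq> -\<infinity>"
    using h z by (auto simp: proper_closed_on_def prox_set_def)
  ultimately show ?thesis
    using w by (cases "h z") auto
qed

text \<open>Closedness only bounds the limiting values from below. The upper bound comes from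
  minimality with the limit \<open>l\<close> as competitor of each \<open>z n\<close>: the change in
  the quadratic term is at most a multiple of \<open>norm (l - z n)\<close>, because the centres
  \<open>v n\<close> are bounded.\<close>

lemma tendsto_prox_values:
  fixes g :: "'a::euclidean_space \<Rightarrow> ereal"
  assumes g: "proper_closed_on UNIV g" and \<eta>: "0 < \<eta>"
    and z: "\<And>n. z n \<in> prox_set UNIV g \<eta> (v n)" and v: "bounded (range v)" and lim: "z \<longlonglongrightarrow> l"
  shows "(\<lambda>n. g (z n)) \<longlonglongrightarrow> g l" and "\<exists>c. g l = ereal c"
proof -
  obtain \<gamma> where \<gamma>: "\<And>n. g (z n) = ereal (\<gamma> n)"
    using prox_set_finite[OF g z] by metis
  obtain B where B: "\<And>n. norm (v n) \<le> B"
    using v by (auto simp: bounded_iff)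
  obtain w c where w: "g w = ereal c"
  proof -
    obtain w where "g w \<noteq> \<infinity>" "g w \<noteq> -\<infinity>"
      using g by (auto simp: proper_closed_on_def)
    then show ?thesis
      using that by (cases "g w") auto
  qed
  have \<gamma>_le: "\<gamma> n + 1 / (2 * \<eta>) * (norm (z n - v n))\<^sup>2 \<le> a + 1 / (2 * \<eta>) * (norm (y - v n))\<^sup>2"
    if "g y = ereal a" for n y a
    using z[of n] that \<gamma>[of n] by (auto simp: prox_set_def dest: spec[of _ y])
  \<comment> \<open>Before \<open>l\<close> can serve as a competitor it must be in the domain;
    comparison with the fixed point \<open>w\<close> of finite value bounds all
    \<open>g (z n)\<close>.\<close>
  have "g l \<le> ereal (c + 1 / (2 * \<eta>) * (norm w + B)\<^sup>2)"
  proof (rule closed_fun_limit_le[OF g _ _ lim])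
    show "(\<lambda>n. c + 1 / (2 * \<eta>) * (norm w + B)\<^sup>2) \<longlonglongrightarrow> c + 1 / (2 * \<eta>) * (norm w + B)\<^sup>2"
      by simp
    fix n
    have "norm (w - v n) \<le> norm w + B"
      using norm_triangle_ineq4[of w "v n"] B[of n] by linarith
    then have "1 / (2 * \<eta>) * (norm (w - v n))\<^sup>2 \<le> 1 / (2 * \<eta>) * (norm w + B)\<^sup>2"
      using \<eta> by (intro mult_left_mono power_mono) auto
    moreover have "0 \<le> 1 / (2 * \<eta>) * (norm (z n - v n))\<^sup>2"
      using \<eta> by simp
    ultimately have "\<gamma> n \<le> c + 1 / (2 * \<eta>) * (norm w + B)\<^sup>2"
      using \<gamma>_le[OF w, of n] by linarith
    then show "g (z n) \<le> ereal (c + 1 / (2 * \<eta>) * (norm w + B)\<^sup>2)"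
      using \<gamma> by simp
  qed auto
  then show "\<exists>c. g l = ereal c"
    using g by (cases "g l") (auto simp: proper_closed_on_def)
  then obtain a where a: "g l = ereal a" by blast
  have upper: "\<gamma> n \<le> a + 1 / \<eta> * ((norm l + B) * norm (l - z n))" for n
  proof -
    have "(norm (l - v n))\<^sup>2 - (norm (z n - v n))\<^sup>2 = 2 * ((l - v n) \<bullet> (l - z n)) - (norm (l - z n))\<^sup>2"
      by (simp add: power2_norm_eq_inner inner_diff_left inner_diff_right inner_commute)
    also have "\<dots> \<le> 2 * (norm (l - v n) * norm (l - z n))"
      using norm_cauchy_schwarz[of "l - v n" "l - z n"] zero_le_power2[of "norm (l - z n)"] by linarith
    also have "\<dots> \<le> 2 * ((norm l + B) * norm (l - z n))"
      using norm_triangle_ineq4[of l "v n"] B[of n] by (intro mult_left_mono mult_right_mono) auto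
    finally have "1 / (2 * \<eta>) * ((norm (l - v n))\<^sup>2 - (norm (z n - v n))\<^sup>2)
        \<le> 1 / (2 * \<eta>) * (2 * ((norm l + B) * norm (l - z n)))"
      using \<eta> by (intro mult_left_mono) auto
    then show ?thesis
      using \<gamma>_le[OF a, of n] by (simp add: right_diff_distrib)
  qed
  have "\<gamma> \<longlonglongrightarrow> a"
  proof (rule order_tendstoI)
    fix d assume "a < d"
    have "(\<lambda>n. a + 1 / \<eta> * ((norm l + B) * norm (l - z n))) \<longlonglongrightarrow> a + 1 / \<eta> * ((norm l + B) * norm (l - l))"
      by (intro tendsto_intros lim)
    then have "\<forall>\<^sub>F n in sequentially. a + 1 / \<eta> * ((norm l + B) * norm (l - z n)) < d"
      using \<open>a < d\<close> by (intro order_tendstoD) auto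
    then show "\<forall>\<^sub>F n in sequentially. \<gamma> n < d"
      by eventually_elim (use upper in \<open>auto intro: le_less_trans\<close>)
  next
    fix d assume "d < a"
    have "closed {y. g y \<le> ereal d}"
      using g by (auto simp: proper_closed_on_def)
    then have "open (- {y. g y \<le> ereal d})" by blast
    moreover have "l \<in> - {y. g y \<le> ereal d}"
      using a \<open>d < a\<close> by simp
    ultimately have "\<forall>\<^sub>F n in sequentially. z n \<in> - {y. g y \<le> ereal d}"
      using lim topological_tendstoD by blast
    then show "\<forall>\<^sub>F n in sequentially. d < \<gamma> n"
      by eventually_elim (simp add: \<gamma>)
  qed
  then show "(\<lambda>n. g (z n)) \<longlonglongrightarrow> g l"
    by (simp add: \<gamma> a)
qed

section \<open>Subgradients\<close>

text \<open>After division by \<open>norm (z - x)\<close> the quadratic error still vanishes in the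
  limit.\<close>

lemma frechet_subdiffI:
  assumes x: "h x = ereal c"
    and low: "\<And>z. ereal (c + u \<bullet> (z - x) - K * (norm (z - x))\<^sup>2) \<le> h z"
  shows "u \<in> frechet_subdiff h x"
proof -
  let ?q = "\<lambda>z. (h z - h x - ereal (u \<bullet> (z - x))) / ereal (norm (z - x))"
  have q: "ereal (- K * norm (z - x)) \<le> ?q z" if "z \<noteq> x" for z
  proof (cases "h z")
    case (real a)
    have n: "0 < norm (z - x)"
      using that by simp
    have "- K * (norm (z - x))\<^sup>2 \<le> a - c - u \<bullet> (z - x)"
      using low[of z] real by simp
    then have "- K * norm (z - x) \<le> (a - c - u \<bullet> (z - x)) / norm (z - x)"
      using n by (simp add: field_simps power2_eq_square)
    then show ?thesis
      using real x n by simp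
  next
    case PInf
    then show ?thesis
      using x that by simp
  next
    case MInf
    then show ?thesis
      using low[of z] by simp
  qed
  have "((\<lambda>z. ereal (- K * norm (z - x))) \<longlongrightarrow> ereal (- K * norm (x - x))) (at x)"
    by (intro tendsto_intros)
  then have lim0: "((\<lambda>z. ereal (- K * norm (z - x))) \<longlongrightarrow> 0) (at x)"
    by (simp add: zero_ereal_def)
  have "0 \<le> Liminf (at x) ?q"
  proof (cases "at x = bot")
    case True
    then show ?thesis by (simp add: Liminf_def)
  next
    case False
    have "Liminf (at x) (\<lambda>z. ereal (- K * norm (z - x))) \<le> Liminf (at x) ?q"
      using q by (intro Liminf_mono) (auto simp: eventually_at_filter)
    then show ?thesis
      using lim_imp_Liminf[OF False lim0] by simp
  qed
  then show ?thesis
    using x by (simp add: frechet_subdiff_def effective_dom_def)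
qed

lemma frechet_subdiff_subset_limiting: "frechet_subdiff h x \<subseteq> limiting_subdiff h x"
proof
  fix u assume u: "u \<in> frechet_subdiff h x"
  then have "x \<in> effective_dom h"
    by (simp add: frechet_subdiff_def)
  with u show "u \<in> limiting_subdiff h x"
    unfolding limiting_subdiff_def
    by (intro CollectI conjI exI[of _ "\<lambda>_. x"] exI[of _ "\<lambda>_. u"]) auto
qed

text \<open>Minimality gives a quadratic minorant of \<open>g\<close> touching at \<open>z\<close>,
  and the Lipschitz gradient gives one of \<open>f\<close>. Their sum is a minorant of the whole
  function, so no sum rule for subdifferentials is invoked.\<close>

lemma prox_subgradient:
  fixes f :: "'a::euclidean_space \<Rightarrow> real"
  assumes grad: "\<And>y. GDERIV f y :> Df y" and lip: "L-lipschitz_on UNIV Df"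
    and g: "proper_closed_on UNIV g" and \<eta>: "0 < \<eta>" and z: "z \<in> prox_set UNIV g \<eta> v"
  shows "Df z - (1 / \<eta>) *\<^sub>R (z - v) \<in> frechet_subdiff (\<lambda>y. ereal (f y) + g y) z"
proof -
  obtain c where c: "g z = ereal c"
    using prox_set_finite[OF g z] by blast
  show ?thesis
  proof (rule frechet_subdiffI[where c = "f z + c" and K = "1 / (2 * \<eta>) + L / 2"])
    show "ereal (f z) + g z = ereal (f z + c)"
      using c by simp
    fix w
    let ?u = "Df z - (1 / \<eta>) *\<^sub>R (z - v)"
    show "ereal (f z + c + ?u \<bullet> (w - z) - (1 / (2 * \<eta>) + L / 2) * (norm (w - z))\<^sup>2) \<le> ereal (f w) + g w"
    proof (cases "g w")
      case (real a)
      have "c + 1 / (2 * \<eta>) * (norm (z - v))\<^sup>2 \<le> a + 1 / (2 * \<eta>) * (norm (w - v))\<^sup>2"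
        using z real c by (auto simp: prox_set_def dest: spec[of _ w])
      \<comment> \<open>Expanding the square around \<open>z\<close> exposes the linear term that
        becomes part of the subgradient.\<close>
      moreover have "1 / (2 * \<eta>) * (norm (w - v))\<^sup>2 = 1 / (2 * \<eta>) * (norm (w - z))\<^sup>2
          + 1 / (2 * \<eta>) * (norm (z - v))\<^sup>2 + (1 / \<eta>) * ((z - v) \<bullet> (w - z))"
        using \<eta> by (simp add: power2_norm_eq_inner inner_diff_left inner_diff_right inner_commute field_simps)
      moreover have "f z + Df z \<bullet> (w - z) - L / 2 * (norm (w - z))\<^sup>2 \<le> f w"
        by (rule lipschitz_gradient_lower[OF grad lip])
      ultimately show ?thesis
        using real by (simp add: inner_diff_left distrib_right)
    next
      case MInf
      then show ?thesis
        using g by (auto simp: proper_closed_on_def)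
    qed simp
  qed
qed

section \<open>Finite length\<close>

lemma summable_or_window_growth:
  fixes a :: "nat \<Rightarrow> real"
  assumes a: "\<And>k. 0 \<le> a k" and r: "1 < r"
    and step: "\<And>t. t0 \<le> t \<Longrightarrow> (\<And>k. k \<le> t \<Longrightarrow> t \<le> k + s \<Longrightarrow> a k \<le> r ^ (t - k) * a t) \<Longrightarrow>
                 a t \<le> r * a (Suc t)"
  shows "summable a \<or> (\<exists>t1. \<forall>t\<ge>t1. a t \<le> r * a (Suc t) \<and>
           (\<forall>k\<le>t. t \<le> k + s \<longrightarrow> a k \<le> r ^ (t - k) * a t))"
proof (cases "\<exists>t1\<ge>t0. \<forall>k\<le>t1. t1 \<le> k + s \<longrightarrow> a k \<le> r ^ (t1 - k) * a t1")
  case True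
  then obtain t1 where t1: "t0 \<le> t1" "\<forall>k\<le>t1. t1 \<le> k + s \<longrightarrow> a k \<le> r ^ (t1 - k) * a t1"
    by blast
  have window: "\<forall>k\<le>t. t \<le> k + s \<longrightarrow> a k \<le> r ^ (t - k) * a t" if "t1 \<le> t" for t
    using that
  proof (induction t rule: dec_induct)
    case base
    show ?case using t1(2) .
  next
    case (step t)
    have grow: "a t \<le> r * a (Suc t)"
      using step t1 assms(3)[of t] by auto
    show ?case
    proof (intro allI impI)
      \<comment> \<open>The new entry \<open>Suc t\<close> is trivial; every other entry lay in the
        previous window and gains one factor \<open>r\<close> from \<open>grow\<close>.\<close>
      fix k assume k: "k \<le> Suc t" "Suc t \<le> k + s"
      show "a k \<le> r ^ (Suc t - k) * a (Suc t)"
      proof (cases "k = Suc t")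
        case False
        then have "a k \<le> r ^ (t - k) * a t"
          using step.IH k by auto
        also have "\<dots> \<le> r ^ (t - k) * (r * a (Suc t))"
          using grow r by (intro mult_left_mono) auto
        also have "\<dots> = r ^ (Suc t - k) * a (Suc t)"
          using False k by (simp add: Suc_diff_le)
        finally show ?thesis .
      qed simp
    qed
  qed
  moreover have "a t \<le> r * a (Suc t)" if "t1 \<le> t" for t
    using window[OF that] that t1(1) by (intro step) auto
  ultimately show ?thesis by blast
next
  case no_start: False
  \<comment> \<open>If the growth property never starts to hold, every late term is dominated by an earlier one
    in its window, which forces geometric decay.\<close>
  define M where "M = (\<Sum>k<t0. a k * r ^ k)"
  have "a t * r ^ t \<le> M" for t
  proof (induction t rule: less_induct)
    case (less t)
    show ?case
    proof (cases "t < t0")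
      case True
      then show ?thesis
        unfolding M_def using a r by (intro member_le_sum) auto
    next
      case False
      then have "\<not> (\<forall>k\<le>t. t \<le> k + s \<longrightarrow> a k \<le> r ^ (t - k) * a t)"
        using no_start by simp
      then obtain k where k: "k \<le> t" "r ^ (t - k) * a t < a k"
        by (auto simp: not_le)
      then have "k \<noteq> t" by auto
      \<comment> \<open>The weights \<open>r ^ t\<close> turn the failed growth inequality into a
        comparison of the weighted terms at \<open>t\<close> and at an earlier \<open>k\<close>,
        where the induction hypothesis applies.\<close>
      have "a t * r ^ t = r ^ (t - k) * a t * r ^ k"
        using k by (simp add: power_add[symmetric] mult.commute mult.left_commute)
      also have "\<dots> \<le> a k * r ^ k"
        using k r by (intro mult_right_mono) auto
      also have "\<dots> \<le> M"
        using less k \<open>k \<noteq> t\<close> by auto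
      finally show ?thesis .
    qed
  qed
  then have "norm (a t) \<le> M * (1 / r) ^ t" for t
    using a r by (simp add: field_simps)
  moreover have "summable (\<lambda>t. M * (1 / r) ^ t)"
    using r by (intro summable_mult summable_geometric) auto
  ultimately show ?thesis
    using summable_comparison_test' by blast
qed

text \<open>The decrease and the subgradient bound involve the same increment \<open>a t\<close>.
  Multiplying the KL inequality by \<open>a t\<close> therefore produces the squared increment that
  the decrease controls, and no inequality between arithmetic and geometric means is
  required.\<close>

lemma KL_summable_increments:
  fixes F :: "'a::euclidean_space \<Rightarrow> ereal" and x u :: "nat \<Rightarrow> 'a"
  assumes KL: "KL_property F" and x: "bounded (range x)"
    and \<Phi>: "\<And>t. F (x t) = ereal (\<Phi> t)" and \<Phi>_low: "\<And>t. m \<le> \<Phi> t"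
    and \<alpha>: "0 < \<alpha>" and decrease: "\<And>t. \<Phi> (Suc t) \<le> \<Phi> t - \<alpha> * (a t)\<^sup>2"
    and u: "\<And>t. u t \<in> limiting_subdiff F (x t)"
    and \<beta>: "0 \<le> \<beta>" and u_le: "\<And>t. norm (u t) \<le> \<beta> * a t" and a: "\<And>t. 0 \<le> a t"
    and cont: "\<And>q l. (\<lambda>n. x (q n)) \<longlonglongrightarrow> l \<Longrightarrow> (\<lambda>n. F (x (q n))) \<longlonglongrightarrow> F l"
  shows "summable a"
proof -
  have dec: "\<Phi> (Suc t) \<le> \<Phi> t" for t
  proof -
    have "0 \<le> \<alpha> * (a t)\<^sup>2"
      using \<alpha> by simp
    then show ?thesis
      using decrease[of t] by linarith
  qed
  then have decseq: "decseq \<Phi>"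
    by (simp add: decseq_Suc_iff)
  then obtain c where c: "\<Phi> \<longlonglongrightarrow> c" "\<And>t. c \<le> \<Phi> t"
    using decseq_convergent[of \<Phi> m] \<Phi>_low by blast
  \<comment> \<open>The set of cluster points of \<open>x\<close>, to which the KL property is
    applied.\<close>
  define \<Omega> where "\<Omega> = (\<Inter>n. closure (x ` {n..}))"
  have subseq_lim: "l \<in> \<Omega>" if q: "(\<lambda>n. x (q n)) \<longlonglongrightarrow> l" "\<And>n. n \<le> q n" for q l
    unfolding \<Omega>_def
  proof (rule INT_I)
    fix n
    have "\<forall>\<^sub>F k in sequentially. x (q k) \<in> closure (x ` {n..})"
      using eventually_ge_at_top[of n]
    proof eventually_elim
      case (elim k)
      then have "q k \<in> {n..}"
        using q(2)[of k] by simp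
      then show ?case
        by (intro subsetD[OF closure_subset] imageI)
    qed
    then show "l \<in> closure (x ` {n..})"
      using q(1) by (intro Lim_in_closed_set[OF closed_closure]) auto
  qed
  have "closed \<Omega>"
    by (auto simp: \<Omega>_def)
  moreover have "\<Omega> \<subseteq> closure (range x)"
    unfolding \<Omega>_def by (rule INF_lower2[of 0]) auto
  ultimately have "compact \<Omega>"
    using x bounded_closure bounded_subset compact_eq_bounded_closed by blast
  have F_\<Omega>: "F l = ereal c" if l: "l \<in> \<Omega>" for l
  proof -
    have "\<exists>k. n \<le> k \<and> dist (x k) l < inverse (real (Suc n))" for n
    proof -
      have "l \<in> closure (x ` {n..})"
        using l by (auto simp: \<Omega>_def)
      then show ?thesis
        unfolding closure_approachable by (auto dest!: spec[of _ "inverse (real (Suc n))"])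
    qed
    \<comment> \<open>The indices need not increase strictly: \<open>q n \<ge> n\<close> already
      makes \<open>\<Phi> (q n)\<close> converge to \<open>c\<close>, and \<open>cont\<close>
      accepts any indices.\<close>
    then obtain q where q: "\<And>n. n \<le> q n" "\<And>n. dist (x (q n)) l < inverse (real (Suc n))"
      by metis
    have "(\<lambda>n. dist (x (q n)) l) \<longlonglongrightarrow> 0"
      by (rule tendsto_sandwich[OF _ _ tendsto_const LIMSEQ_inverse_real_of_nat])
        (use q(2) in \<open>auto intro!: always_eventually less_imp_le[OF q(2)] simp del: of_nat_Suc\<close>)
    then have "(\<lambda>n. x (q n)) \<longlonglongrightarrow> l"
      by (rule tendsto_dist_iff[THEN iffD2])
    then have "(\<lambda>n. ereal (\<Phi> (q n))) \<longlonglongrightarrow> F l"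
      using cont[of q l] by (simp add: \<Phi>)
    moreover have "filterlim q at_top sequentially"
      using q(1) by (intro filterlim_at_top_mono[OF filterlim_ident]) auto
    then have "(\<lambda>n. ereal (\<Phi> (q n))) \<longlonglongrightarrow> ereal c"
      using filterlim_compose[OF c(1)] by (intro tendsto_intros) auto
    ultimately show ?thesis
      using LIMSEQ_unique by blast
  qed
  have \<Omega>_dom: "\<Omega> \<subseteq> effective_dom F" "\<exists>c. \<forall>y\<in>\<Omega>. F y = c"
    using F_\<Omega> by (auto simp: effective_dom_def)
  obtain y where y: "y \<in> \<Omega>"
  proof -
    obtain l q where "strict_mono (q :: nat \<Rightarrow> nat)" "(x \<circ> q) \<longlonglongrightarrow> l"
      using x bounded_imp_convergent_subsequence by blast
    then show ?thesis
      using that subseq_lim[of q l] by (auto simp: o_def seq_suble)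
  qed
  obtain \<epsilon> l \<phi> \<phi>' where \<epsilon>: "0 < \<epsilon>" and l: "0 < l"
    and concave: "concave_on {0..<l} \<phi>" and \<phi>_nonneg: "\<And>v. v \<in> {0..<l} \<Longrightarrow> 0 \<le> \<phi> v"
    and \<phi>': "\<And>v. v \<in> {0<..<l} \<Longrightarrow> (\<phi> has_real_derivative \<phi>' v) (at v) \<and> 0 < \<phi>' v"
    and KL_ineq: "\<And>y z. y \<in> \<Omega> \<Longrightarrow> edist_to \<Omega> z < ereal \<epsilon> \<Longrightarrow> F y < F z \<Longrightarrow> F z < F y + ereal l \<Longrightarrow>
        1 \<le> ereal (\<phi>' (real_of_ereal (F z - F y))) * edist_to (limiting_subdiff F z) 0"
  proof -
    have "compact \<Omega> \<and> \<Omega> \<subseteq> effective_dom F \<and> (\<exists>c. \<forall>y\<in>\<Omega>. F y = c)"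
      using \<open>compact \<Omega>\<close> \<Omega>_dom by blast
    from KL[unfolded KL_property_def, rule_format, OF this] show thesis
      apply (elim exE conjE)
      subgoal premises prems for \<epsilon> l \<phi> \<phi>'
        by (rule that[of \<epsilon> l \<phi> \<phi>']) (use prems in blast)+
      done
  qed
  \<comment> \<open>Otherwise infinitely many terms stay at distance at least
    \<open>\<epsilon>\<close> from \<open>\<Omega>\<close>; by boundedness they have a cluster
    point, which belongs to \<open>\<Omega>\<close>.\<close>
  have near: "\<forall>\<^sub>F t in sequentially. edist_to \<Omega> (x t) < ereal \<epsilon>"
  proof (rule ccontr)
    assume "\<not> ?thesis"
    then have "\<forall>n. \<exists>k\<ge>n. \<not> edist_to \<Omega> (x k) < ereal \<epsilon>"
      by (auto simp: eventually_sequentially)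
    then obtain q where q: "\<And>n. n \<le> q n" "\<And>n. \<not> edist_to \<Omega> (x (q n)) < ereal \<epsilon>"
      by metis
    have "bounded (range (\<lambda>n. x (q n)))"
      using x by (rule bounded_subset) auto
    then obtain z p where p: "strict_mono (p :: nat \<Rightarrow> nat)" "((\<lambda>n. x (q n)) \<circ> p) \<longlonglongrightarrow> z"
      using bounded_imp_convergent_subsequence by blast
    then have lim: "(\<lambda>n. x (q (p n))) \<longlonglongrightarrow> z"
      by (simp add: o_def)
    have "z \<in> \<Omega>"
      by (rule subseq_lim[OF lim]) (use q(1) seq_suble[OF p(1)] order_trans in blast)
    moreover have "\<forall>\<^sub>F n in sequentially. dist (x (q (p n))) z < \<epsilon>"
      using lim \<epsilon> by (rule tendstoD)
    then obtain n where "dist (x (q (p n))) z < \<epsilon>"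
      by (auto dest: eventually_happens)
    ultimately have "edist_to \<Omega> (x (q (p n))) < ereal \<epsilon>"
      unfolding edist_to_def by (intro INF_less_iff[THEN iffD2]) (auto simp: dist_commute)
    then show False
      using q(2) by blast
  qed
  moreover have "\<forall>\<^sub>F t in sequentially. \<Phi> t < c + l"
    using c(1) l by (intro order_tendstoD) auto
  ultimately have "\<forall>\<^sub>F t in sequentially. edist_to \<Omega> (x t) < ereal \<epsilon> \<and> \<Phi> t < c + l"
    by (rule eventually_conj)
  then obtain N where N: "\<And>t. N \<le> t \<Longrightarrow> edist_to \<Omega> (x t) < ereal \<epsilon> \<and> \<Phi> t < c + l"
    unfolding eventually_sequentially by blast
  define \<psi> where "\<psi> t = \<phi> (\<Phi> t - c)" for t
  have step: "a t \<le> \<beta> / \<alpha> * (\<psi> t - \<psi> (Suc t))" if t: "N \<le> t" for t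
  proof (cases "\<Phi> t = c")
    \<comment> \<open>The KL inequality requires a value strictly above \<open>c\<close>. Once the
      limit value is reached, the decrease forces \<open>a t = 0\<close>.\<close>
    case True
    then have "\<Phi> (Suc t) = c"
      using dec[of t] c(2)[of "Suc t"] by simp
    then have "\<alpha> * (a t)\<^sup>2 \<le> 0"
      using decrease[of t] True by simp
    then have "a t = 0"
      using \<alpha> by (simp add: mult_le_0_iff)
    then show ?thesis
      using True \<open>\<Phi> (Suc t) = c\<close> by (simp add: \<psi>_def)
  next
    case False
    define \<delta> where "\<delta> = \<Phi> t - c"
    have \<delta>: "\<delta> \<in> {0<..<l}"
      using False c(2)[of t] N[OF t] by (auto simp: \<delta>_def)
    have dist_le: "edist_to (limiting_subdiff F (x t)) 0 \<le> ereal (norm (u t))"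
      unfolding edist_to_def by (rule INF_lower2[OF u]) simp
    have "1 \<le> ereal (\<phi>' \<delta>) * edist_to (limiting_subdiff F (x t)) 0"
      using KL_ineq[OF y, of "x t"] N[OF t] \<delta> F_\<Omega>[OF y] by (auto simp: \<Phi> \<delta>_def)
    also have "\<dots> \<le> ereal (\<phi>' \<delta>) * ereal (norm (u t))"
      using dist_le \<phi>'[OF \<delta>] by (intro ereal_mult_left_mono) auto
    finally have "1 \<le> \<phi>' \<delta> * norm (u t)"
      by simp
    also have "\<dots> \<le> \<phi>' \<delta> * (\<beta> * a t)"
      using \<phi>'[OF \<delta>] u_le by (intro mult_left_mono) auto
    finally have one: "1 \<le> \<phi>' \<delta> * (\<beta> * a t)" .
    have \<delta>': "\<Phi> (Suc t) - c \<in> {0..<l}"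
      using c(2)[of "Suc t"] N[OF t] dec[of t] by auto
    have "convex_on {0..<l} (\<lambda>v. - \<phi> v)"
      using concave by (simp add: concave_on_def)
    moreover have "((\<lambda>v. - \<phi> v) has_real_derivative - \<phi>' \<delta>) (at \<delta> within {0..<l})"
      using \<phi>'[OF \<delta>] by (intro has_field_derivative_at_within[OF DERIV_minus]) blast
    \<comment> \<open>The tangent is taken at the interior point \<open>\<delta>\<close>. The next
      value may equal \<open>c\<close>, so 0 must be allowed as an argument of
      \<open>\<phi>\<close>, but no derivative is taken there.\<close>
    ultimately have "- \<phi> (\<Phi> (Suc t) - c) - - \<phi> \<delta> \<ge> - \<phi>' \<delta> * (\<Phi> (Suc t) - c - \<delta>)"
      using \<delta> \<delta>' by (intro convex_on_imp_above_tangent) auto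
    then have "\<phi>' \<delta> * (\<Phi> t - \<Phi> (Suc t)) \<le> \<psi> t - \<psi> (Suc t)"
      by (simp add: \<psi>_def \<delta>_def algebra_simps)
    moreover have "\<phi>' \<delta> * (\<alpha> * (a t)\<^sup>2) \<le> \<phi>' \<delta> * (\<Phi> t - \<Phi> (Suc t))"
      using \<phi>'[OF \<delta>] decrease[of t] by (intro mult_left_mono) auto
    ultimately have "\<phi>' \<delta> * (\<alpha> * (a t)\<^sup>2) \<le> \<psi> t - \<psi> (Suc t)"
      by linarith
    then have "\<beta> / \<alpha> * (\<phi>' \<delta> * (\<alpha> * (a t)\<^sup>2)) \<le> \<beta> / \<alpha> * (\<psi> t - \<psi> (Suc t))"
      using \<alpha> \<beta> by (intro mult_left_mono) auto
    moreover have "\<beta> / \<alpha> * (\<phi>' \<delta> * (\<alpha> * (a t)\<^sup>2)) = \<phi>' \<delta> * (\<beta> * a t) * a t"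
      using \<alpha> by (simp add: power2_eq_square)
    moreover have "1 * a t \<le> \<phi>' \<delta> * (\<beta> * a t) * a t"
      using one a by (intro mult_right_mono) auto
    ultimately show ?thesis by simp
  qed
  have "summable (\<lambda>k. a (k + N))"
  proof (rule summableI_nonneg_bounded)
    fix n
    have "(\<Sum>k<n. a (k + N)) \<le> (\<Sum>k<n. \<beta> / \<alpha> * (\<psi> (k + N) - \<psi> (Suc (k + N))))"
      by (intro sum_mono step) simp
    also have "\<dots> = \<beta> / \<alpha> * (\<psi> N - \<psi> (n + N))"
      unfolding sum_distrib_left[symmetric] using sum_lessThan_telescope'[of "\<lambda>k. \<psi> (k + N)" n] by simp
    also have "\<dots> \<le> \<beta> / \<alpha> * \<psi> N"
    proof (rule mult_left_mono)
      have "0 \<le> \<psi> (n + N)"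
        unfolding \<psi>_def using c(2)[of "n + N"] N[of "n + N"] by (intro \<phi>_nonneg) auto
      then show "\<psi> N - \<psi> (n + N) \<le> \<psi> N" by simp
    qed (use \<alpha> \<beta> in simp)
    finally show "(\<Sum>k<n. a (k + N)) \<le> \<beta> / \<alpha> * \<psi> N" .
  qed (use a in auto)
  then show ?thesis
    by simp
qed

section \<open>The algorithm\<close>

text \<open>The setting of the theorem with every machine always active, a named lower bound
  \<open>m\<close> of the objective, and one common constant in place of the individual
  \<open>\<Lambda> i \<eta>\<close>.\<close>

locale mpapg =
  fixes b :: "'n::finite \<Rightarrow> 'p::finite"
    and f :: "real ^ 'n \<Rightarrow> real" and Df :: "real ^ 'n \<Rightarrow> real ^ 'n"
    and g :: "real ^ 'n \<Rightarrow> ereal" and gi :: "'p \<Rightarrow> real ^ 'n \<Rightarrow> ereal"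
    and P :: "'p \<Rightarrow> real \<Rightarrow> real ^ 'n \<Rightarrow> real ^ 'n"
    and \<tau> :: "'p \<Rightarrow> 'p \<Rightarrow> nat \<Rightarrow> nat" and s :: nat
    and L r C \<eta> m :: real and x :: "nat \<Rightarrow> real ^ 'n"
  assumes grad: "\<And>y. GDERIV f y :> Df y"
    and L_pos: "0 < L" and lip: "L-lipschitz_on UNIV Df"
    and g: "proper_closed_on UNIV g"
    and gi: "\<And>i. proper_closed_on (block_space b i) (gi i)"
    and separable: "\<And>y. g y = (\<Sum>i\<in>UNIV. gi i (block b i y))"
    and F_low: "\<And>y. ereal m \<le> ereal (f y) + g y"
    and P: "prox_selection b gi P"
    and delay_le: "\<And>i j t. \<tau> i j t \<le> t" and delay_bound: "\<And>i j t. t - \<tau> i j t \<le> s"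
    and delay_self: "\<And>i t. \<tau> i i t = t"
    and r: "1 < r" and C: "C = (r ^ (s + 1) - 1) / (r - 1)"
    and \<eta>_pos: "0 < \<eta>" and \<eta>_less: "L * (1 + 2 * sqrt (real CARD('p)) * C) < 1 / \<eta>"
    and algorithm: "\<And>i t. block b i (x (Suc t)) =
          P i \<eta> (block b i (x t) - \<eta> *\<^sub>R block b i (Df (local_seq b \<tau> x i t)))"
    and prox_lipschitz: "\<And>i. prox_lipschitz_at (prox_residual b P Df) \<eta>
          ((r\<^sup>2 - 1) / (2 * real CARD('p) * r\<^sup>2 * C\<^sup>2)) (local_seq b \<tau> x i)"
    and x_bounded: "bounded (range x)"
begin

abbreviation "F \<equiv> \<lambda>y. ereal (f y) + g y"

definition "incr t = norm (x (Suc t) - x t)"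

text \<open>For \<open>t < s\<close> the truncated subtraction only repeats the term \<open>incr 0\<close>.\<close>

definition "window t = (\<Sum>j\<le>s. incr (t - j))"

definition "delayed_grad t = join_blocks b (\<lambda>i. Df (local_seq b \<tau> x i t))"

definition "fwd t = x t - \<eta> *\<^sub>R delayed_grad t"

section \<open>Delays and window sums\<close>

lemma incr_nonneg [simp]: "0 \<le> incr t"
  by (simp add: incr_def)

text \<open>\<open>C\<close> is the total weight of a window in which an entry of age
  \<open>j\<close> may exceed the newest one by the factor \<open>r ^ j\<close>.\<close>

lemma C_eq: "C = (\<Sum>j\<le>s. r ^ j)"
  using r by (simp add: C geometric_sum[of r "Suc s"] lessThan_Suc_atMost[symmetric] del: sum.lessThan_Suc)

lemma C_ge_1: "1 \<le> C"
proof -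
  have "r ^ 0 \<le> (\<Sum>j\<le>s. r ^ j)"
    using r by (intro member_le_sum) auto
  then show ?thesis
    by (simp add: C_eq)
qed

lemma sum_incr_le_window: "(\<Sum>k\<in>{t - s..<Suc t}. norm (x (Suc k) - x k)) \<le> window t"
proof -
  have "{t - s..<Suc t} \<subseteq> (\<lambda>j. t - j) ` {..s}"
  proof
    fix k assume "k \<in> {t - s..<Suc t}"
    then have "k = t - (t - k)" "t - k \<le> s" by auto
    then show "k \<in> (\<lambda>j. t - j) ` {..s}" by blast
  qed
  then have "sum incr {t - s..<Suc t} \<le> sum incr ((\<lambda>j. t - j) ` {..s})"
    by (intro sum_mono2) auto
  \<comment> \<open>For \<open>t < s\<close> the reindexing by age is not injective, hence only an
    inequality.\<close>
  also have "\<dots> \<le> sum (incr \<circ> (\<lambda>j. t - j)) {..s}"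
    by (rule sum_image_le) auto
  finally show ?thesis
    by (simp add: window_def incr_def)
qed

text \<open>One interval contains the delayed times of two consecutive clocks, so the same window
  bounds both the movement of a local sequence and its lag.\<close>

lemma delay_range: "\<tau> i j t \<in> {t - s..Suc t}" "\<tau> i j (Suc t) \<in> {t - s..Suc t}"
  using delay_le[of i j t] delay_bound[of t i j] delay_le[of i j "Suc t"] delay_bound[of "Suc t" i j]
  by auto

lemma local_seq_step: "norm (local_seq b \<tau> x i (Suc t) - local_seq b \<tau> x i t) \<le> window t"
  unfolding local_seq_def
  by (rule order_trans[OF norm_delayed_diff_le sum_incr_le_window]) (rule delay_range)+

lemma local_seq_lag:
  assumes "k \<in> {t, Suc t}"
  shows "norm (x k - local_seq b \<tau> x i t) \<le> window t"
proof -
  have "norm (join_blocks b (\<lambda>j. x k) - join_blocks b (\<lambda>j. x (\<tau> i j t)))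
      \<le> (\<Sum>k\<in>{t - s..<Suc t}. norm (x (Suc k) - x k))"
    using assms delay_range(1) by (intro norm_delayed_diff_le) auto
  then show ?thesis
    using sum_incr_le_window[of t] by (simp add: local_seq_def)
qed

text \<open>The case \<open>k = t\<close> serves the descent estimate, and \<open>k = Suc t\<close>
  the subgradient, which lives at the new iterate. Blocks of \<open>delayed_grad t\<close> come from
  different points, so the Lipschitz bound is applied to each block separately.\<close>

lemma delayed_grad_error:
  assumes "k \<in> {t, Suc t}"
  shows "norm (Df (x k) - delayed_grad t) \<le> sqrt (real CARD('p)) * (L * window t)"
proof (rule norm_le_sqrt_card_blocks[where b = b])
  fix i
  have "norm (block b i (Df (x k) - delayed_grad t)) = norm (block b i (Df (x k) - Df (local_seq b \<tau> x i t)))"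
    by (simp add: block_diff delayed_grad_def)
  also have "\<dots> \<le> norm (Df (x k) - Df (local_seq b \<tau> x i t))"
    by (rule norm_block_le)
  also have "\<dots> \<le> L * norm (x k - local_seq b \<tau> x i t)"
    using lipschitz_onD[OF lip] by (simp add: dist_norm)
  also have "\<dots> \<le> L * window t"
    using L_pos assms by (intro mult_left_mono local_seq_lag) auto
  finally show "norm (block b i (Df (x k) - delayed_grad t)) \<le> L * window t" .
qed

section \<open>Existence of the proximal points\<close>

lemma L_less: "L < 1 / \<eta>"
proof -
  have "L * 1 \<le> L * (1 + 2 * sqrt (real CARD('p)) * C)"
    using L_pos C_ge_1 by (intro mult_left_mono) auto
  then show ?thesis
    using \<eta>_less by linarith
qed

lemma closed_block_space: "closed (block_space b i)"
  by (rule closed_subspace) (auto simp: subspace_def block_space_def)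

text \<open>Freezing the other blocks at a point of the domain turns the lower bound on \<open>F\<close> into a
  quadratic lower bound on the single term \<open>gi i\<close>.\<close>

lemma gi_lower_bound:
  assumes w: "w \<in> block_space b i"
  shows "\<exists>c A. \<forall>z\<in>block_space b i. ereal (c - A * norm (z - w) - L / 2 * (norm (z - w))\<^sup>2) \<le> gi i z"
proof -
  obtain y where y: "g y \<noteq> \<infinity>"
    using g by (auto simp: proper_closed_on_def)
  have "\<exists>e. gi j (block b j y) = ereal e" for j
  proof -
    have "gi j (block b j y) \<noteq> -\<infinity>"
      using gi[of j] by (auto simp: proper_closed_on_def)
    moreover have "gi j (block b j y) \<noteq> \<infinity>"
      using y unfolding separable by (auto simp: sum_Pinfty)
    ultimately show ?thesis
      by (cases "gi j (block b j y)") auto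
  qed
  then obtain e where e: "\<And>j. gi j (block b j y) = ereal (e j)"
    by metis
  define E where "E = (\<Sum>j\<in>UNIV - {i}. e j)"
  define Y where "Y z = z + (y - block b i y)" for z
  have g_Y: "g (Y z) = gi i z + ereal E" if z: "z \<in> block_space b i" for z
  proof -
    have bi: "block b i (Y z) = z"
      using block_of_space[OF z] by (simp add: Y_def block_add block_diff)
    have bj: "block b j (Y z) = block b j y" if "j \<noteq> i" for j
      using z that by (auto simp: vec_eq_iff Y_def block_space_def)
    have "g (Y z) = gi i z + (\<Sum>j\<in>UNIV - {i}. gi j (block b j (Y z)))"
      unfolding separable by (subst sum.remove[of _ i]) (auto simp: bi)
    also have "(\<Sum>j\<in>UNIV - {i}. gi j (block b j (Y z))) = (\<Sum>j\<in>UNIV - {i}. ereal (e j))"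
      by (intro sum.cong) (auto simp: bj e)
    finally show ?thesis
      by (simp add: E_def)
  qed
  have "ereal (m - E - f (Y w) - norm (Df (Y w)) * norm (z - w) - L / 2 * (norm (z - w))\<^sup>2) \<le> gi i z"
    if z: "z \<in> block_space b i" for z
  proof (cases "gi i z")
    case (real v)
    \<comment> \<open>The lower bound at \<open>Y z\<close> and the upper quadratic model of
      \<open>f\<close> around \<open>Y w\<close> together bound \<open>v\<close> from below; the
      slope \<open>A\<close> is the gradient norm at \<open>Y w\<close>.\<close>
    have "m \<le> f (Y z) + v + E"
      using F_low[of "Y z"] by (simp add: g_Y[OF z] real)
    moreover have "f (Y z) \<le> f (Y w) + Df (Y w) \<bullet> (z - w) + L / 2 * (norm (z - w))\<^sup>2"
      using lipschitz_gradient_upper[OF grad lip, of "Y z" "Y w"] by (simp add: Y_def)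
    moreover have "Df (Y w) \<bullet> (z - w) \<le> norm (Df (Y w)) * norm (z - w)"
      by (rule norm_cauchy_schwarz)
    ultimately show ?thesis
      by (simp add: real)
  next
    case MInf
    then show ?thesis
      using gi[of i] z by (auto simp: proper_closed_on_def)
  qed simp
  then show ?thesis by blast
qed

lemma prox_step: "x (Suc t) \<in> prox_set UNIV g \<eta> (fwd t)"
proof (rule prox_set_separable[of g gi b])
  fix i
  have fwd: "block b i (x t) - \<eta> *\<^sub>R block b i (Df (local_seq b \<tau> x i t)) = block b i (fwd t)"
    by (simp add: fwd_def delayed_grad_def block_diff block_scaleR)
  obtain c A where low: "\<And>z. z \<in> block_space b i \<Longrightarrow>
      ereal (c - A * norm (z - block b i (fwd t)) - L / 2 * (norm (z - block b i (fwd t)))\<^sup>2) \<le> gi i z"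
    using gi_lower_bound[OF block_in_space[of b i "fwd t"]] by blast
  \<comment> \<open>The selection is constrained only where the argmin is nonempty, which
    \<open>L < 1 / \<eta>\<close> ensures.\<close>
  have "prox_set (block_space b i) (gi i) \<eta> (block b i (fwd t)) \<noteq> {}"
    using gi closed_block_space low \<eta>_pos L_less by (rule prox_set_nonempty)
  then show "block b i (x (Suc t)) \<in> prox_set (block_space b i) (gi i) \<eta> (block b i (fwd t))"
    using P \<eta>_pos unfolding algorithm fwd prox_selection_def by simp
qed (rule separable)

section \<open>Boundedness and convergence of objective values\<close>

lemma window_bounded: "\<exists>B. \<forall>t. window t \<le> B"
proof -
  obtain B where B: "\<And>t. norm (x t) \<le> B"
    using x_bounded by (auto simp: bounded_iff)
  have "incr t \<le> 2 * B" for t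
    using norm_triangle_ineq4[of "x (Suc t)" "x t"] B[of t] B[of "Suc t"] unfolding incr_def by linarith
  then have "window t \<le> (\<Sum>j\<le>s. 2 * B)" for t
    unfolding window_def by (intro sum_mono)
  then show ?thesis by blast
qed

text \<open>Supplies the bounded centres for \<open>tendsto_prox_values\<close>: the delayed
  gradient is compared with \<open>Df (x t)\<close>, and that with \<open>Df 0\<close>.\<close>

lemma fwd_bounded: "bounded (range fwd)"
proof -
  obtain B where B: "\<And>t. norm (x t) \<le> B"
    using x_bounded by (auto simp: bounded_iff)
  obtain B' where B': "\<And>t. window t \<le> B'"
    using window_bounded by blast
  have "norm (fwd t) \<le> B + \<eta> * (sqrt (real CARD('p)) * (L * B') + (L * B + norm (Df 0)))" for t
  proof -
    have "norm (delayed_grad t - Df (x t)) \<le> sqrt (real CARD('p)) * (L * B')"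
    proof -
      have "sqrt (real CARD('p)) * (L * window t) \<le> sqrt (real CARD('p)) * (L * B')"
        using L_pos B' by (intro mult_left_mono) auto
      moreover have "norm (delayed_grad t - Df (x t)) \<le> sqrt (real CARD('p)) * (L * window t)"
        using delayed_grad_error[of t t] by (simp add: norm_minus_commute)
      ultimately show ?thesis
        by (rule order_trans[rotated])
    qed
    moreover have "norm (Df (x t) - Df 0) \<le> L * B"
    proof -
      have "norm (Df (x t) - Df 0) \<le> L * norm (x t)"
        using lipschitz_onD[OF lip, of "x t" 0] by (simp add: dist_norm)
      then show ?thesis
        using L_pos B[of t] by (meson less_imp_le mult_left_mono order_trans)
    qed
    ultimately have "norm (delayed_grad t) \<le> sqrt (real CARD('p)) * (L * B') + (L * B + norm (Df 0))"
      using norm_triangle_sub[of "delayed_grad t" "Df (x t)"] norm_triangle_sub[of "Df (x t)" "Df 0"]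
      by linarith
    then have "norm (\<eta> *\<^sub>R delayed_grad t) \<le> \<eta> * (sqrt (real CARD('p)) * (L * B') + (L * B + norm (Df 0)))"
      using \<eta>_pos by simp
    then show ?thesis
      unfolding fwd_def using norm_triangle_ineq4[of "x t" "\<eta> *\<^sub>R delayed_grad t"] B[of t] by linarith
  qed
  then show ?thesis
    by (auto simp: bounded_iff)
qed

text \<open>The shift by one matters: \<open>x 0\<close> is arbitrary and may have infinite value,
  while every later iterate is a proximal point.\<close>

lemma F_tendsto:
  assumes lim: "(\<lambda>n. x (Suc (q n))) \<longlonglongrightarrow> l"
  shows "(\<lambda>n. F (x (Suc (q n)))) \<longlonglongrightarrow> F l" and "F l < \<infinity>"
proof -
  have bdd: "bounded (range (\<lambda>n. fwd (q n)))"
    using fwd_bounded by (rule bounded_subset) auto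
  note vals = tendsto_prox_values[OF g \<eta>_pos prox_step bdd lim]
  obtain c where c: "g l = ereal c"
    using vals(2) by blast
  have "isCont f l"
    using grad[of l] unfolding gderiv_def by (rule has_derivative_continuous)
  then have "(\<lambda>n. f (x (Suc (q n)))) \<longlonglongrightarrow> f l"
    using lim by (rule isCont_tendsto_compose)
  then show "(\<lambda>n. F (x (Suc (q n)))) \<longlonglongrightarrow> F l"
    using vals(1) c by (intro tendsto_add_ereal tendsto_ereal) auto
  show "F l < \<infinity>"
    using c by simp
qed

section \<open>Descent and subgradient estimates\<close>

lemma g_finite: "\<exists>c. g (x (Suc t)) = ereal c"
  using prox_set_finite[OF g prox_step] .

lemma F_value: "F (x (Suc t)) = ereal (real_of_ereal (F (x (Suc t))))"
  using g_finite[of t] by auto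

text \<open>The old iterate is a competitor in the proximal problem of the new one. Adding the
  quadratic upper model of \<open>f\<close>, the linear terms cancel up to the error of the delayed
  gradient. The index starts at \<open>Suc t\<close> so that both values are finite.\<close>

lemma descent:
  "real_of_ereal (F (x (Suc (Suc t)))) \<le> real_of_ereal (F (x (Suc t)))
     - (1 / \<eta> - L) / 2 * (incr (Suc t))\<^sup>2 + incr (Suc t) * (sqrt (real CARD('p)) * (L * window (Suc t)))"
proof -
  let ?y = "x (Suc t)" and ?z = "x (Suc (Suc t))" and ?v = "fwd (Suc t)"
  obtain c d where c: "g ?y = ereal c" and d: "g ?z = ereal d"
    using g_finite by metis
  let ?S = "?z - ?y"
  have "d + 1 / (2 * \<eta>) * (norm (?z - ?v))\<^sup>2 \<le> c + 1 / (2 * \<eta>) * (norm (?y - ?v))\<^sup>2"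
    using prox_step[of "Suc t"] c d by (auto simp: prox_set_def dest: spec[of _ ?y])
  moreover have "1 / (2 * \<eta>) * (norm (?z - ?v))\<^sup>2 = 1 / (2 * \<eta>) * (norm (?y - ?v))\<^sup>2
      + 1 / (2 * \<eta>) * (norm ?S)\<^sup>2 + (1 / \<eta>) * ((?y - ?v) \<bullet> ?S)"
    using \<eta>_pos by (simp add: power2_norm_eq_inner inner_diff_left inner_diff_right inner_commute field_simps)
  moreover have "(1 / \<eta>) * ((?y - ?v) \<bullet> ?S) = delayed_grad (Suc t) \<bullet> ?S"
    using \<eta>_pos by (simp add: fwd_def)
  moreover have "f ?z \<le> f ?y + Df ?y \<bullet> ?S + L / 2 * (norm ?S)\<^sup>2"
    by (rule lipschitz_gradient_upper[OF grad lip])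
  moreover have "Df ?y \<bullet> ?S - delayed_grad (Suc t) \<bullet> ?S \<le> incr (Suc t) * (sqrt (real CARD('p)) * (L * window (Suc t)))"
  proof -
    have "Df ?y \<bullet> ?S - delayed_grad (Suc t) \<bullet> ?S \<le> norm (Df ?y - delayed_grad (Suc t)) * norm ?S"
      using norm_cauchy_schwarz[of "Df ?y - delayed_grad (Suc t)" ?S] by (simp add: inner_diff_left)
    also have "\<dots> \<le> sqrt (real CARD('p)) * (L * window (Suc t)) * norm ?S"
      using delayed_grad_error[of "Suc t" "Suc t"] by (intro mult_right_mono) auto
    finally show ?thesis
      by (simp add: incr_def mult.commute)
  qed
  moreover have "(1 / \<eta> - L) / 2 * (norm ?S)\<^sup>2 = 1 / (2 * \<eta>) * (norm ?S)\<^sup>2 - L / 2 * (norm ?S)\<^sup>2"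
    by (simp add: diff_divide_distrib left_diff_distrib)
  ultimately have "f ?z + d \<le> f ?y + c - (1 / \<eta> - L) / 2 * (norm ?S)\<^sup>2
      + incr (Suc t) * (sqrt (real CARD('p)) * (L * window (Suc t)))"
    by linarith
  then show ?thesis
    by (simp add: c d incr_def)
qed

definition "subgrad t = Df (x (Suc t)) - (1 / \<eta>) *\<^sub>R (x (Suc t) - fwd t)"

lemma subgrad: "subgrad t \<in> frechet_subdiff F (x (Suc t))"
  unfolding subgrad_def by (rule prox_subgradient[OF grad lip g \<eta>_pos prox_step])

lemma norm_subgrad_le: "norm (subgrad t) \<le> incr t / \<eta> + sqrt (real CARD('p)) * (L * window t)"
proof -
  have "subgrad t = (Df (x (Suc t)) - delayed_grad t) - (1 / \<eta>) *\<^sub>R (x (Suc t) - x t)"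
    using \<eta>_pos by (simp add: subgrad_def fwd_def scaleR_diff_right)
  then have "norm (subgrad t) \<le> norm (Df (x (Suc t)) - delayed_grad t) + norm ((1 / \<eta>) *\<^sub>R (x (Suc t) - x t))"
    using norm_triangle_ineq4 by metis
  also have "norm ((1 / \<eta>) *\<^sub>R (x (Suc t) - x t)) = incr t / \<eta>"
    using \<eta>_pos by (simp add: incr_def)
  finally show ?thesis
    using delayed_grad_error[of "Suc t" t] by simp
qed

section \<open>Growth of the increments\<close>

lemma incr_diff:
  "\<forall>\<^sub>F t in sequentially. incr t - incr (Suc t)
     \<le> sqrt (real CARD('p)) * ((r\<^sup>2 - 1) / (2 * real CARD('p) * r\<^sup>2 * C\<^sup>2) * window t)"
proof -
  let ?\<kappa> = "(r\<^sup>2 - 1) / (2 * real CARD('p) * r\<^sup>2 * C\<^sup>2)"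
  let ?\<Delta> = "\<lambda>i t. prox_residual b P Df \<eta> (local_seq b \<tau> x i t)"
  have "0 \<le> ?\<kappa>"
    using r by (intro divide_nonneg_nonneg) auto
  \<comment> \<open>Since a machine sees its own block without delay, the \<open>i\<close>-th block
    of the residual at its local point is exactly the increment it performs. The proximal Lipschitz
    inequality thus controls the change of increments.\<close>
  have \<Delta>: "block b i (?\<Delta> i t) = block b i (x (Suc t) - x t)" for i t
  proof -
    have "block b i (local_seq b \<tau> x i t) = block b i (x t)"
      by (simp add: local_seq_def delay_self)
    moreover have "block b i (P i \<eta> (block b i (x t) - \<eta> *\<^sub>R block b i (Df (local_seq b \<tau> x i t))))
        = block b i (x (Suc t))"
      by (simp add: algorithm[symmetric])
    ultimately show ?thesis
      by (simp add: prox_residual_def block_diff block_scaleR)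
  qed
  have "\<forall>\<^sub>F t in sequentially. \<forall>i. norm (?\<Delta> i t - ?\<Delta> i (Suc t))
      \<le> ?\<kappa> * norm (local_seq b \<tau> x i t - local_seq b \<tau> x i (Suc t))"
    using prox_lipschitz by (simp add: prox_lipschitz_at_def eventually_all_finite)
  then show ?thesis
  proof eventually_elim
    case (elim t)
    have "norm ((x (Suc t) - x t) - (x (Suc (Suc t)) - x (Suc t))) \<le> sqrt (real CARD('p)) * (?\<kappa> * window t)"
    proof (rule norm_le_sqrt_card_blocks[where b = b])
      fix i
      have "norm (block b i ((x (Suc t) - x t) - (x (Suc (Suc t)) - x (Suc t))))
          = norm (block b i (?\<Delta> i t - ?\<Delta> i (Suc t)))"
        by (simp only: block_diff \<Delta>[unfolded block_diff])
      also have "\<dots> \<le> norm (?\<Delta> i t - ?\<Delta> i (Suc t))"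
        by (rule norm_block_le)
      also have "\<dots> \<le> ?\<kappa> * norm (local_seq b \<tau> x i t - local_seq b \<tau> x i (Suc t))"
        using elim by blast
      also have "\<dots> \<le> ?\<kappa> * window t"
        using \<open>0 \<le> ?\<kappa>\<close> local_seq_step[of i t] by (intro mult_left_mono) (auto simp: norm_minus_commute)
      finally show "norm (block b i ((x (Suc t) - x t) - (x (Suc (Suc t)) - x (Suc t)))) \<le> ?\<kappa> * window t" .
    qed
    moreover have "incr t - incr (Suc t) \<le> norm ((x (Suc t) - x t) - (x (Suc (Suc t)) - x (Suc t)))"
      unfolding incr_def by (rule norm_triangle_ineq2)
    ultimately show ?case by linarith
  qed
qed

lemma window_le:
  assumes "\<And>k. k \<le> t \<Longrightarrow> t \<le> k + s \<Longrightarrow> incr k \<le> r ^ (t - k) * incr t"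
  shows "window t \<le> C * incr t"
proof -
  have "window t \<le> (\<Sum>j\<le>s. r ^ j * incr t)"
    unfolding window_def
  proof (rule sum_mono)
    fix j assume "j \<in> {..s}"
    then have "incr (t - j) \<le> r ^ (t - (t - j)) * incr t"
      by (intro assms) auto
    \<comment> \<open>With truncated subtraction the exponent is the minimum of \<open>t\<close> and
      \<open>j\<close>.\<close>
    also have "\<dots> \<le> r ^ j * incr t"
      using r by (intro mult_right_mono power_increasing) auto
    finally show "incr (t - j) \<le> r ^ j * incr t" .
  qed
  then show ?thesis
    by (simp add: C_eq sum_distrib_right)
qed

text \<open>The factors sqrt p / p and \<open>1 / C\<close> are at most 1. What remains is, with q =
  1 / r, the inequality (1 - q^2) / 2 \<le> 1 - q, that is, (1 - q)^2 \<ge> 0.\<close>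

lemma ratio_constant:
  assumes "0 \<le> d"
  shows "sqrt (real CARD('p)) * ((r\<^sup>2 - 1) / (2 * real CARD('p) * r\<^sup>2 * C\<^sup>2) * (C * d)) \<le> (1 - 1 / r) * d"
proof -
  define N where "N = real CARD('p)"
  have N: "1 \<le> N"
    unfolding N_def using zero_less_card_finite[where 'a = 'p] by simp
  have sqrt: "sqrt N / N \<le> 1"
    using N by (simp add: real_le_lsqrt power2_eq_square)
  have "sqrt (real CARD('p)) * ((r\<^sup>2 - 1) / (2 * real CARD('p) * r\<^sup>2 * C\<^sup>2) * (C * d))
      = (sqrt N / N) * (1 / C) * ((r\<^sup>2 - 1) / (2 * r\<^sup>2) * d)"
    using C_ge_1 N r unfolding N_def[symmetric] by (simp add: power2_eq_square field_simps)
  also have "\<dots> \<le> 1 * 1 * ((r\<^sup>2 - 1) / (2 * r\<^sup>2) * d)"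
    using C_ge_1 N r sqrt assms
    by (intro mult_right_mono mult_mono mult_nonneg_nonneg divide_nonneg_nonneg) auto
  also have "\<dots> \<le> (1 - 1 / r) * d"
  proof -
    have "(1 - 1 / r) - (r\<^sup>2 - 1) / (2 * r\<^sup>2) = (r - 1)\<^sup>2 / (2 * r\<^sup>2)"
      using r by (simp add: power2_eq_square field_simps)
    moreover have "0 \<le> (r - 1)\<^sup>2 / (2 * r\<^sup>2)"
      by simp
    ultimately have "(r\<^sup>2 - 1) / (2 * r\<^sup>2) \<le> 1 - 1 / r"
      by linarith
    from mult_right_mono[OF this assms] show ?thesis
      by (simp only: mult_1)
  qed
  finally show ?thesis .
qed

lemma growth_dichotomy:
  "summable incr \<or> (\<exists>t1. \<forall>t\<ge>t1. incr t \<le> r * incr (Suc t) \<and>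
      (\<forall>k\<le>t. t \<le> k + s \<longrightarrow> incr k \<le> r ^ (t - k) * incr t))"
proof -
  let ?\<kappa> = "(r\<^sup>2 - 1) / (2 * real CARD('p) * r\<^sup>2 * C\<^sup>2)"
  obtain t0 where t0: "\<And>t. t0 \<le> t \<Longrightarrow> incr t - incr (Suc t) \<le> sqrt (real CARD('p)) * (?\<kappa> * window t)"
    using incr_diff by (auto simp: eventually_sequentially)
  have "0 \<le> ?\<kappa>"
    using r by (intro divide_nonneg_nonneg) auto
  show ?thesis
  proof (rule summable_or_window_growth)
    fix t assume t: "t0 \<le> t" and growth: "\<And>k. k \<le> t \<Longrightarrow> t \<le> k + s \<Longrightarrow> incr k \<le> r ^ (t - k) * incr t"
    have "sqrt (real CARD('p)) * (?\<kappa> * window t) \<le> sqrt (real CARD('p)) * (?\<kappa> * (C * incr t))"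
      using \<open>0 \<le> ?\<kappa>\<close> window_le[OF growth] by (intro mult_left_mono) auto
    then have "incr t - incr (Suc t) \<le> (1 - 1 / r) * incr t"
      using t0[OF t] ratio_constant[of "incr t"] by simp
    then have "incr t / r \<le> incr (Suc t)"
      by (simp add: left_diff_distrib)
    then show "incr t \<le> r * incr (Suc t)"
      using r by (simp add: field_simps)
  qed (use r in auto)
qed

section \<open>Finite length and convergence\<close>

lemma summable_incr:
  assumes KL: "KL_property F"
  shows "summable incr"
proof (rule ccontr)
  assume not: "\<not> summable incr"
  then have "\<exists>N. \<forall>t\<ge>N. incr t \<le> r * incr (Suc t) \<and>
      (\<forall>k\<le>t. t \<le> k + s \<longrightarrow> incr k \<le> r ^ (t - k) * incr t)"
    using growth_dichotomy by simp
  then obtain N where ratio: "\<And>t. N \<le> t \<Longrightarrow> incr t \<le> r * incr (Suc t)"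
    and growth: "\<And>t k. N \<le> t \<Longrightarrow> k \<le> t \<Longrightarrow> t \<le> k + s \<Longrightarrow> incr k \<le> r ^ (t - k) * incr t"
    by auto
  have window_C: "window t \<le> C * incr t" if "N \<le> t" for t
    using growth[OF that] by (rule window_le)
  \<comment> \<open>\<open>\<alpha>\<close> is what remains of the descent coefficient after
    bounding the window by \<open>C\<close> times its newest increment; the step size makes it
    positive. The factor \<open>r\<close> in \<open>\<beta>\<close> moves the subgradient bound from
    \<open>incr t\<close> to \<open>incr (Suc t)\<close>, the increment that appears in the
    decrease.\<close>
  define \<alpha> where "\<alpha> = (1 / \<eta> - L) / 2 - sqrt (real CARD('p)) * (L * C)"
  define \<beta> where "\<beta> = (1 / \<eta> + sqrt (real CARD('p)) * (L * C)) * r"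
  have "0 < \<alpha>"
    using \<eta>_less by (simp add: \<alpha>_def algebra_simps)
  \<comment> \<open>The shift by \<open>N\<close> enters the range of the growth property, and the
    extra \<open>Suc\<close> ensures finite objective values.\<close>
  have "summable (\<lambda>t. incr (Suc (t + N)))"
  proof (rule KL_summable_increments[OF KL, where x = "\<lambda>t. x (Suc (t + N))" and \<alpha> = \<alpha> and \<beta> = \<beta>
        and u = "\<lambda>t. subgrad (t + N)" and m = m and \<Phi> = "\<lambda>t. real_of_ereal (F (x (Suc (t + N))))"])
    show "bounded (range (\<lambda>t. x (Suc (t + N))))"
      using x_bounded by (rule bounded_subset) auto
    show "m \<le> real_of_ereal (F (x (Suc (t + N))))" for t
      using F_low[of "x (Suc (t + N))"] F_value[of "t + N"] by (metis ereal_less_eq(3))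
    show "real_of_ereal (F (x (Suc (Suc t + N))))
        \<le> real_of_ereal (F (x (Suc (t + N)))) - \<alpha> * (incr (Suc (t + N)))\<^sup>2" for t
    proof -
      let ?a = "incr (Suc (t + N))"
      have "?a * (sqrt (real CARD('p)) * (L * window (Suc (t + N)))) \<le> ?a * (sqrt (real CARD('p)) * (L * (C * ?a)))"
        using L_pos by (intro mult_left_mono window_C) auto
      also have "\<dots> = sqrt (real CARD('p)) * (L * C) * ?a\<^sup>2"
        by (simp add: power2_eq_square)
      finally have "?a * (sqrt (real CARD('p)) * (L * window (Suc (t + N))))
          \<le> sqrt (real CARD('p)) * (L * C) * ?a\<^sup>2" .
      moreover have "\<alpha> * ?a\<^sup>2 = (1 / \<eta> - L) / 2 * ?a\<^sup>2 - sqrt (real CARD('p)) * (L * C) * ?a\<^sup>2"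
        by (simp only: \<alpha>_def left_diff_distrib)
      ultimately show ?thesis
        unfolding add_Suc using descent[of "t + N"] by linarith
    qed
    show "norm (subgrad (t + N)) \<le> \<beta> * incr (Suc (t + N))" for t
    proof -
      have "norm (subgrad (t + N)) \<le> incr (t + N) / \<eta> + sqrt (real CARD('p)) * (L * (C * incr (t + N)))"
        using L_pos window_C[of "t + N"]
        by (intro order_trans[OF norm_subgrad_le] add_left_mono mult_left_mono) auto
      also have "\<dots> = (1 / \<eta> + sqrt (real CARD('p)) * (L * C)) * incr (t + N)"
        by (simp add: distrib_right)
      also have "\<dots> \<le> (1 / \<eta> + sqrt (real CARD('p)) * (L * C)) * (r * incr (Suc (t + N)))"
        using L_pos C_ge_1 \<eta>_pos ratio[of "t + N"] by (intro mult_left_mono) auto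
      finally show ?thesis
        by (simp add: \<beta>_def mult.assoc)
    qed
    show "subgrad (t + N) \<in> limiting_subdiff F (x (Suc (t + N)))" for t
      using subgrad frechet_subdiff_subset_limiting by blast
    show "(\<lambda>n. F (x (Suc (q n + N)))) \<longlonglongrightarrow> F l"
      if "(\<lambda>n. x (Suc (q n + N))) \<longlonglongrightarrow> l" for q l
      using F_tendsto(1)[of "\<lambda>n. q n + N", OF that] .
    show "0 \<le> \<beta>"
      using L_pos C_ge_1 \<eta>_pos r by (simp add: \<beta>_def)
  qed (use \<open>0 < \<alpha>\<close> F_value in auto)
  then have "summable (\<lambda>t. incr (t + Suc N))"
    by simp
  with not show False
    unfolding summable_iff_shift by blast
qed

lemma summable_window:
  assumes "summable incr"
  shows "summable window"
proof -
  have "summable (\<lambda>t. incr (t - j))" for j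
    using assms summable_iff_shift[of "\<lambda>t. incr (t - j)" j] by simp
  then show ?thesis
    unfolding window_def by (intro summable_sum) auto
qed

lemma convergence:
  assumes KL: "KL_property F"
  shows "summable (\<lambda>t. norm (x (Suc t) - x t)) \<and>
         (\<forall>i. summable (\<lambda>t. norm (local_seq b \<tau> x i (Suc t) - local_seq b \<tau> x i t))) \<and>
         (\<exists>x_lim\<in>crit F. x \<longlonglongrightarrow> x_lim \<and> (\<forall>i. local_seq b \<tau> x i \<longlonglongrightarrow> x_lim))"
proof (intro conjI allI)
  note incr = summable_incr[OF KL]
  note window = summable_window[OF incr]
  show sum: "summable (\<lambda>t. norm (x (Suc t) - x t))"
    using incr by (simp add: incr_def[abs_def])
  show "summable (\<lambda>t. norm (local_seq b \<tau> x i (Suc t) - local_seq b \<tau> x i t))" for i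
    by (rule summable_comparison_test'[OF window]) (simp add: local_seq_step)
  \<comment> \<open>Absolutely summable increments telescope to a limit.\<close>
  obtain S where "(\<lambda>n. \<Sum>k<n. x (Suc k) - x k) \<longlonglongrightarrow> S"
    using summable_LIMSEQ[OF summable_norm_cancel[OF sum]] by blast
  then have "(\<lambda>n. (x n - x 0) + x 0) \<longlonglongrightarrow> S + x 0"
    unfolding sum_lessThan_telescope by (intro tendsto_intros)
  then have lim: "x \<longlonglongrightarrow> S + x 0"
    by simp
  have local_lim: "local_seq b \<tau> x i \<longlonglongrightarrow> S + x 0" for i
  proof -
    have "(\<lambda>t. x t - local_seq b \<tau> x i t) \<longlonglongrightarrow> 0"
      using local_seq_lag[of _ _ i]
      by (intro Lim_null_comparison[OF _ summable_LIMSEQ_zero[OF window]] always_eventually) auto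
    from tendsto_diff[OF lim this] show ?thesis by simp
  qed
  have "(\<lambda>t. incr t / \<eta> + sqrt (real CARD('p)) * (L * window t)) \<longlonglongrightarrow> 0 / \<eta> + sqrt (real CARD('p)) * (L * 0)"
    using \<eta>_pos by (intro tendsto_intros summable_LIMSEQ_zero incr window) auto
  then have "(\<lambda>t. incr t / \<eta> + sqrt (real CARD('p)) * (L * window t)) \<longlonglongrightarrow> 0"
    by simp
  then have "subgrad \<longlonglongrightarrow> 0"
    by (rule Lim_null_comparison[rotated]) (simp add: norm_subgrad_le)
  moreover have lim': "(\<lambda>t. x (Suc t)) \<longlonglongrightarrow> S + x 0"
    using lim by (simp add: LIMSEQ_Suc)
  \<comment> \<open>The sequences \<open>x (Suc t)\<close> and \<open>subgrad t\<close> witness that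
    0 is a limiting subgradient; convergence of the objective values is part of that
    definition.\<close>
  ultimately have "S + x 0 \<in> crit F"
    using F_tendsto[OF lim'] subgrad
    unfolding crit_def limiting_subdiff_def effective_dom_def by blast
  then show "\<exists>x_lim\<in>crit F. x \<longlonglongrightarrow> x_lim \<and> (\<forall>i. local_seq b \<tau> x i \<longlonglongrightarrow> x_lim)"
    using lim local_lim by blast
qed

end

theorem theorem6p4:
  fixes b :: "'n::finite \<Rightarrow> 'p::finite"
    and f :: "real ^ 'n \<Rightarrow> real" and Df :: "real ^ 'n \<Rightarrow> real ^ 'n"
    and g :: "real ^ 'n \<Rightarrow> ereal" and gi :: "'p \<Rightarrow> real ^ 'n \<Rightarrow> ereal"
    and F :: "real ^ 'n \<Rightarrow> ereal"
    and P :: "'p \<Rightarrow> real \<Rightarrow> real ^ 'n \<Rightarrow> real ^ 'n"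
    and T :: "'p \<Rightarrow> nat set" and \<tau> :: "'p \<Rightarrow> 'p \<Rightarrow> nat \<Rightarrow> nat" and s :: nat
    and L r C \<eta> :: real and \<Lambda> :: "'p \<Rightarrow> real \<Rightarrow> real"
    and x :: "nat \<Rightarrow> real ^ 'n"
  assumes grad: "\<And>y. GDERIV f y :> Df y"
    and L_pos: "0 < L" and grad_lipschitz: "L-lipschitz_on UNIV Df"
    and g: "proper_closed_on UNIV g"
    and gi: "\<And>i. proper_closed_on (block_space b i) (gi i)"
    and separable: "\<And>y. g y = (\<Sum>i\<in>UNIV. gi i (block b i y))"
    and F: "F = (\<lambda>y. ereal (f y) + g y)"
    and F_bounded_below: "\<exists>m::real. \<forall>y. ereal m \<le> F y"
    and F_KL: "KL_property F"
    and P: "prox_selection b gi P"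
    and delay_le: "\<And>i j t. \<tau> i j t \<le> t" and delay_bound: "\<And>i j t. t - \<tau> i j t \<le> s"
    and delay_self: "\<And>i t. \<tau> i i t = t"
    and always_active: "\<And>i t. t \<in> T i"
    and r: "1 < r" and C: "C = (r ^ (s + 1) - 1) / (r - 1)"
    and \<eta>_pos: "0 < \<eta>"
    and \<eta>_less: "\<eta> < 1 / (L * (1 + 2 * sqrt (real CARD('p)) * C + 2 * sqrt (real CARD('p)) * real s))"
    and algorithm: "mPAPG b T \<tau> P Df \<eta> x"
    and prox_lipschitz:
      "\<And>i. proximal_lipschitz_with (\<Lambda> i) (prox_residual b P Df) (local_seq b \<tau> x i)"
    and prox_lipschitz_\<eta>:
      "\<And>i. prox_lipschitz_at (prox_residual b P Df) \<eta> (\<Lambda> i \<eta>) (local_seq b \<tau> x i)"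
    and \<Lambda>_\<eta>: "\<And>i. \<Lambda> i \<eta> \<le> (r\<^sup>2 - 1) / (2 * real CARD('p) * r\<^sup>2 * C\<^sup>2)"
    and x_bounded: "bounded (range x)"
  shows "summable (\<lambda>t. norm (x (t + 1) - x t)) \<and>
         (\<forall>i. summable (\<lambda>t. norm (local_seq b \<tau> x i (t + 1) - local_seq b \<tau> x i t))) \<and>
         (\<exists>x_lim\<in>crit F. x \<longlonglongrightarrow> x_lim \<and> (\<forall>i. local_seq b \<tau> x i \<longlonglongrightarrow> x_lim))"
proof -
  obtain m :: real where m: "\<And>y. ereal m \<le> F y"
    using F_bounded_below by blast
  let ?p = "sqrt (real CARD('p))"
  have "0 \<le> C"
    using r one_le_power[of r "s + 1"] unfolding C by (intro divide_nonneg_nonneg) auto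
  then have pos: "0 < L * (1 + 2 * ?p * C + 2 * ?p * real s)"
    using L_pos by (intro mult_pos_pos add_pos_nonneg) auto
  have "L * (1 + 2 * ?p * C) \<le> L * (1 + 2 * ?p * C + 2 * ?p * real s)"
    using L_pos by (intro mult_left_mono) auto
  also have "\<dots> < 1 / \<eta>"
    using \<eta>_less \<eta>_pos pos by (simp add: field_simps)
  finally have \<eta>_less': "L * (1 + 2 * ?p * C) < 1 / \<eta>" .
  \<comment> \<open>Each individual constant can be enlarged to the common bound because it
    multiplies a norm.\<close>
  have lipschitz: "prox_lipschitz_at (prox_residual b P Df) \<eta>
      ((r\<^sup>2 - 1) / (2 * real CARD('p) * r\<^sup>2 * C\<^sup>2)) (local_seq b \<tau> x i)" for i
    using prox_lipschitz_\<eta>[of i] unfolding prox_lipschitz_at_def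
    by (rule eventually_mono) (meson \<Lambda>_\<eta> mult_right_mono norm_ge_zero order_trans)
  interpret mpapg b f Df g gi P \<tau> s L r C \<eta> m x
  proof
    show "ereal m \<le> ereal (f y) + g y" for y
      using m F by simp
    show "block b i (x (Suc t)) =
        P i \<eta> (block b i (x t) - \<eta> *\<^sub>R block b i (Df (local_seq b \<tau> x i t)))" for i t
      using algorithm always_active by (simp add: mPAPG_def)
  qed (rule grad L_pos grad_lipschitz g gi separable P delay_le delay_bound delay_self r C
      \<eta>_pos \<eta>_less' lipschitz x_bounded)+
  show ?thesis
    using convergence F_KL by (simp add: F)
qed

end
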